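(* For all $(u,v)\in\mathbb{C}^2$: (i) $(\llbracket\cdot,\cdot\rrbracket^{u,v}_n)_{n\ge0}$ is a formal deformation of $\mathcal K$; (ii) $\llbracket\mathcal K_{k,p},\mathcal K_{\ell,q}\rrbracket^{u,v}_n\subset\mathcal K_{k+\ell+2n,p+q}$; (iii) for all $f\in\mathcal M_k$, $g\in\mathcal M_\ell$ (modular forms, viewed in $\mathcal K$ as polynomials in $E_4,E_6$) and $n\ge0$, $\llbracket f,g\rrbracket^{u,v}_n\in\mathcal Q$ and $\omega(\llbracket f,g\rrbracket^{u,v}_n)=\mathrm{RC}_n(f,g)$; in particular $\llbracket f,g\rrbracket^{u,v}_n\in\mathcal M_*$, so $\mathcal M_*$ is stable and the restriction of the deformation to $\mathcal M_*$ is given by the usual Rankin–Cohen brackets.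
   Context: Let $\mathcal K=\mathbb{C}[E_4,E_6,A,A^{-1},B]$ be the localization at $A$ of the polynomial algebra $\mathbb{C}[E_4,E_6,A,B]$ in algebraically independent variables, bigraded by weight and index ($E_4$: $(4,0)$, $E_6$: $(6,0)$, $A$: $(-2,1)$, $B$: $(0,1)$), with components $\mathcal K_{k,p}$. Set $F_2=BA^{-1}$ (weight 2, index 0), $\mathcal Q=\mathbb{C}[E_4,E_6,F_2]$, $\mathcal M_*=\mathbb{C}[E_4,E_6]$ with weight-$k$ part $\mathcal M_k$. For $u\in\mathbb{C}$, $\partial_u$ is the derivation of $\mathcal K$ with $\partial_u(E_4)=-\frac13(E_6-E_4F_2)$, $\partial_u(E_6)=-\frac12(E_4^2-E_6F_2)$, $\partial_u(F_2)=-\frac1{12}(E_4-F_2^2)$, $\partial_u(A)=uAF_2=uB$ (hence $\partial_u(B)=(u+\frac1{12})BF_2-\frac1{12}E_4A$). For $f\in\mathcal K_{k,p}$, $g\in\mathcal K_{\ell,q}$: $\llbracket f,g\rrbracket^{u,v}_n=\sum_{r=0}^n(-1)^r\binom{k+vp+n-1}{n-r}\binom{\ell+vq+n-1}{r}\partial_u^r(f)\partial_u^{n-r}(g)$, extended bilinearly (complex binomials). Let $E_2,E_4,E_6$ also denote the Eisenstein series on the upper half plane ($E_2=1-24\sum\sigma_1(n)q^n$, $E_4=1+240\sum\sigma_3(n)q^n$, $E_6=1-504\sum\sigma_5(n)q^n$, $q=e^{2\pi i\tau}$), which are algebraically independent; identify $\mathcal M^{\le\infty}_*=\mathbb{C}[E_2,E_4,E_6]$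 with the algebra of functions they generate, and let $\omega:\mathcal Q\to\mathcal M^{\le\infty}_*$ be the algebra isomorphism fixing $E_4,E_6$ with $F_2\mapsto E_2$. With $D=\frac1{2\pi i}\frac{d}{d\tau}$, the Rankin–Cohen brackets are $\mathrm{RC}_n(f,g)=\sum_{i=0}^n(-1)^i\binom{k+n-1}{n-i}\binom{\ell+n-1}{i}D^i(f)D^{n-i}(g)$ for $f\in\mathcal M_k$, $g\in\mathcal M_\ell$. A formal deformation of a commutative algebra $R$ is a sequence $(\mu_j)$ of bilinear maps, $\mu_0$ the product, with $\sum_{r=0}^n\mu_{n-r}(\mu_r(f,g),h)=\sum_{r=0}^n\mu_{n-r}(f,\mu_r(g,h))$ for all $n,f,g,h$. *)

theory Defs
  imports "HOL-Analysis.Analysis" "HOL-Library.Poly_Mapping"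
begin

text \<open>Exponent vectors (a,b,c,d) of monomials E4^a E6^b A^c B^d (c may be negative:
  localization at A).  The algebra K = C[E4,E6,A,A^-1,B] is the algebra of finitely
  supported functions from exponent vectors to complex numbers (convolution product).\<close>

type_synonym expo = "nat \<times> nat \<times> int \<times> nat"
type_synonym K = "expo \<Rightarrow>\<^sub>0 complex"

definition Kconst :: "complex \<Rightarrow> K" where
  "Kconst c = Poly_Mapping.single 0 c"

definition X :: "expo \<Rightarrow> K" where
  "X m = Poly_Mapping.single m 1"

definition vE4 :: K where "vE4 = X (1,0,0,0)"
definition vE6 :: K where "vE6 = X (0,1,0,0)"
definition vA :: K where "vA = X (0,0,1,0)"
definition vAinv :: K where "vAinv = X (0,0,-1,0)"
definition vB :: K where "vB = X (0,0,0,1)"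
definition vF2 :: K where "vF2 = vB * vAinv"

fun wt :: "expo \<Rightarrow> int" where
  "wt (a,b,c,d) = 4 * int a + 6 * int b - 2 * c"
fun idx :: "expo \<Rightarrow> int" where
  "idx (a,b,c,d) = c + int d"

definition Kdeg :: "int \<Rightarrow> int \<Rightarrow> K set" where
  "Kdeg k p = {f. \<forall>m\<in>Poly_Mapping.keys f. wt m = k \<and> idx m = p}"

definition dE4 :: K where "dE4 = Kconst (-1/3) * (vE6 - vE4 * vF2)"
definition dE6 :: K where "dE6 = Kconst (-1/2) * (vE4^2 - vE6 * vF2)"
definition dA :: "complex \<Rightarrow> K" where "dA u = Kconst u * vB"
definition dB :: "complex \<Rightarrow> K" where
  "dB u = Kconst (u + 1/12) * vB * vF2 - Kconst (1/12) * vE4 * vA"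

fun dmono :: "complex \<Rightarrow> expo \<Rightarrow> K" where
  "dmono u (a,b,c,d) =
     of_nat a * X (a-1,b,c,d) * dE4 + of_nat b * X (a,b-1,c,d) * dE6
   + of_int c * X (a,b,c-1,d) * dA u + of_nat d * X (a,b,c,d-1) * dB u"

definition dd :: "complex \<Rightarrow> K \<Rightarrow> K" where
  "dd u f = (\<Sum>m\<in>Poly_Mapping.keys f. Kconst (Poly_Mapping.lookup f m) * dmono u m)"

definition hcomp :: "int \<Rightarrow> int \<Rightarrow> K \<Rightarrow> K" where
  "hcomp k p f = (\<Sum>m\<in>{m\<in>Poly_Mapping.keys f. wt m = k \<and> idx m = p}. Kconst (Poly_Mapping.lookup f m) * X m)"

definition degs :: "K \<Rightarrow> (int \<times> int) set" where
  "degs f = (\<lambda>m. (wt m, idx m)) ` Poly_Mapping.keys f"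

definition br :: "complex \<Rightarrow> complex \<Rightarrow> nat \<Rightarrow> K \<Rightarrow> K \<Rightarrow> K" where
  "br u v n f g =
    (\<Sum>(k,p)\<in>degs f. \<Sum>(l,q)\<in>degs g. \<Sum>r\<le>n.
       Kconst ((-1)^r * ((of_int k + v * of_int p + of_nat n - 1) gchoose (n - r))
                      * ((of_int l + v * of_int q + of_nat n - 1) gchoose r))
       * (dd u ^^ r) (hcomp k p f) * (dd u ^^ (n - r)) (hcomp l q g))"

definition formal_deformation :: "(nat \<Rightarrow> K \<Rightarrow> K \<Rightarrow> K) \<Rightarrow> bool" where
  "formal_deformation \<mu> \<longleftrightarrow>
     (\<forall>n f f' g. \<mu> n (f + f') g = \<mu> n f g + \<mu> n f' g) \<and>
     (\<forall>n f g g'. \<mu> n f (g + g') = \<mu> n f g + \<mu> n f g') \<and>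
     (\<forall>n c f g. \<mu> n (Kconst c * f) g = Kconst c * \<mu> n f g) \<and>
     (\<forall>n c f g. \<mu> n f (Kconst c * g) = Kconst c * \<mu> n f g) \<and>
     (\<forall>f g. \<mu> 0 f g = f * g) \<and>
     (\<forall>n f g h. (\<Sum>r\<le>n. \<mu> (n - r) (\<mu> r f g) h) = (\<Sum>r\<le>n. \<mu> (n - r) f (\<mu> r g h)))"

text \<open>subalgebras: Q = C[E4,E6,F2] (monomials E4^a E6^b A^(-d) B^d), M_* = C[E4,E6], M_k\<close>
definition Qalg :: "K set" where
  "Qalg = {f. \<forall>(a,b,c,d)\<in>Poly_Mapping.keys f. c = - int d}"
definition Mstar :: "K set" where
  "Mstar = {f. \<forall>(a,b,c,d)\<in>Poly_Mapping.keys f. c = 0 \<and> d = 0}"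
definition Mk :: "int \<Rightarrow> K set" where
  "Mk k = {f. \<forall>(a,b,c,d)\<in>Poly_Mapping.keys f. c = 0 \<and> d = 0 \<and> 4 * int a + 6 * int b = k}"

definition sigma :: "nat \<Rightarrow> nat \<Rightarrow> nat" where
  "sigma j n = (\<Sum>d\<in>{d. d dvd n}. d ^ j)"

definition qterm :: "nat \<Rightarrow> complex \<Rightarrow> complex" where
  "qterm n \<tau> = exp (2 * of_real pi * \<i> * of_nat n * \<tau>)"

definition Eis2 :: "complex \<Rightarrow> complex" where
  "Eis2 \<tau> = 1 - 24 * suminf (\<lambda>n. of_nat (sigma 1 (Suc n)) * qterm (Suc n) \<tau>)"
definition Eis4 :: "complex \<Rightarrow> complex" where
  "Eis4 \<tau> = 1 + 240 * suminf (\<lambda>n. of_nat (sigma 3 (Suc n)) * qterm (Suc n) \<tau>)"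
definition Eis6 :: "complex \<Rightarrow> complex" where
  "Eis6 \<tau> = 1 - 504 * suminf (\<lambda>n. of_nat (sigma 5 (Suc n)) * qterm (Suc n) \<tau>)"

text \<open>omega: E4 -> E4, E6 -> E6, F2 -> E2 (meaningful on Qalg, where A^(-d)B^d = F2^d)\<close>
definition omega :: "K \<Rightarrow> complex \<Rightarrow> complex" where
  "omega f \<tau> = (\<Sum>m\<in>Poly_Mapping.keys f. (case m of (a,b,c,d) \<Rightarrow>
      Poly_Mapping.lookup f m * Eis4 \<tau> ^ a * Eis6 \<tau> ^ b * Eis2 \<tau> ^ d))"

definition Dop :: "(complex \<Rightarrow> complex) \<Rightarrow> complex \<Rightarrow> complex" where
  "Dop F \<tau> = deriv F \<tau> / (2 * of_real pi * \<i>)"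

definition RC :: "int \<Rightarrow> int \<Rightarrow> nat \<Rightarrow> (complex \<Rightarrow> complex) \<Rightarrow> (complex \<Rightarrow> complex)
                   \<Rightarrow> complex \<Rightarrow> complex" where
  "RC k l n F G \<tau> = (\<Sum>i\<le>n. (-1)^i * ((of_int k + of_nat n - 1) gchoose (n - i))
        * ((of_int l + of_nat n - 1) gchoose i) * (Dop ^^ i) F \<tau> * (Dop ^^ (n - i)) G \<tau>)"

end

theory Submission
  imports Defs
begin

text \<open>
  To an element f of weight k attach F(X,Y) = Y^(-k) f(X/Y), with the given derivation playing the role
  of differentiation.  The n-th bracket of f and g is then the n-th transvectant of F and G divided
  by n!, so the deformation is the Moyal product, whose associativity is the binomial theorem for
  w12 + w13 + w23 with wij = p_i q_j - q_i p_j.  That transvectants again have the form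
  Y^(-m) h(X/Y) follows from homogeneity in Y and invariance under X \<mapsto> X + cY.  Since only the
  additivity of the weight is used, the same argument covers the weight k + vp.

  On index 0 the commutator of d/dF2 with the given derivation is 1/12 of the weight.  It follows that
  d/dF2 kills the brackets of modular forms, so these do not involve F2.

  The comparison with Eisenstein series amounts to Ramanujan's differential equations.  These
  reduce to convolution identities for divisor sums, which come from
  substitutions in the positive quadruples (a,b,x,y) with ax + by = n.
\<close>

text \<open>For a complex weight k, Y^(-k) f(X/Y) lies in no algebra at hand. Only its derivatives
  at (X, Y) = (0, 1) are used, where they are scalar multiples of iterates of the derivation.
  Constant coefficient operators on three such functions become polynomials in six commuting
  symbols. To feed one bracket into another, all derivatives of the inner one at that point must be
  known: Euler's relation supplies those in Y, shear invariance those in X. Only the left-nested sum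
  is computed; the right-nested one follows because w12 + w13 + w23 changes sign when the first and
  third indices are exchanged. The parameters disappear on modular forms for two separate reasons: v
  multiplies the index, which is 0, and u cancels in the derivative of F2 = B/A. Ramanujan's
  equations are proved coefficientwise, so neither modularity of the Eisenstein series nor a
  dimension count enters. The polynomial summed over quadruples is chosen so that its change under b
  \<mapsto> a + b is a combination of the products of odd powers occurring in the
  convolutions.\<close>

lemma update_conv_add:
  fixes f :: "'m \<Rightarrow>\<^sub>0 'c::comm_monoid_add"
  shows "a \<notin> Poly_Mapping.keys f \<Longrightarrow> Poly_Mapping.update a b f = Poly_Mapping.single a b + f"
  by (intro poly_mapping_eqI)
    (auto simp: lookup_update lookup_add lookup_single when_def in_keys_iff)

lemma poly_mapping_linear_induct [case_names zero add]:
  fixes f :: "'m \<Rightarrow>\<^sub>0 'c::comm_monoid_add"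
  assumes "P 0" and "\<And>m c f. P f \<Longrightarrow> P (Poly_Mapping.single m c + f)"
  shows "P f"
proof (induction f rule: update_induct)
  case const
  show ?case by (fact assms(1))
next
  case (update f a b)
  with update_conv_add[of a f b] assms(2) show ?case by metis
qed

section \<open>Linear maps prescribed on monomials\<close>

abbreviation cst :: "complex \<Rightarrow> ('m::comm_monoid_add \<Rightarrow>\<^sub>0 complex)" where
  "cst \<equiv> Poly_Mapping.single 0"

definition unital_ring_hom :: "('c::comm_ring_1 \<Rightarrow> 'r::comm_ring_1) \<Rightarrow> bool" where
  "unital_ring_hom \<kappa> \<longleftrightarrow> \<kappa> 1 = 1 \<and> (\<forall>x y. \<kappa> (x + y) = \<kappa> x + \<kappa> y) \<and> (\<forall>x y. \<kappa> (x * y) = \<kappa> x * \<kappa> y)"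

lemma unital_ring_hom_zero: "unital_ring_hom \<kappa> \<Longrightarrow> \<kappa> 0 = 0"
  unfolding unital_ring_hom_def by (metis add_cancel_right_left)

lemma unital_ring_hom_id: "unital_ring_hom (\<lambda>x. x)"
  by (simp add: unital_ring_hom_def)

lemma unital_ring_hom_cst: "unital_ring_hom cst"
  by (simp add: unital_ring_hom_def single_add mult_single)

lemma cst_mult: "cst (a * b) = cst a * cst b"
  by (simp add: mult_single)

lemma cst_mult_left: "cst a * (cst b * f) = cst (a * b) * f"
  by (simp add: cst_mult mult.assoc)

text \<open>One operator covers the linear maps of the development: with \<open>cst\<close> as
  scalar map it yields \<open>dd\<close>, \<open>xder\<close>, \<open>lower\<close>,
  \<open>euler\<close>, \<open>ev\<close> and \<open>swap13\<close>; with the identity it yields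
  \<open>omega\<close>, whose values are numbers.\<close>

definition lext :: "('c::comm_ring_1 \<Rightarrow> 'r::comm_ring_1) \<Rightarrow> ('m \<Rightarrow> 'r) \<Rightarrow> ('m \<Rightarrow>\<^sub>0 'c) \<Rightarrow> 'r" where
  "lext \<kappa> \<phi> f = (\<Sum>m\<in>Poly_Mapping.keys f. \<kappa> (Poly_Mapping.lookup f m) * \<phi> m)"

lemma lext_superset:
  assumes "unital_ring_hom \<kappa>" "finite S" "Poly_Mapping.keys f \<subseteq> S"
  shows "lext \<kappa> \<phi> f = (\<Sum>m\<in>S. \<kappa> (Poly_Mapping.lookup f m) * \<phi> m)"
  unfolding lext_def using assms
  by (intro sum.mono_neutral_left) (auto simp: in_keys_iff unital_ring_hom_zero)

context
  fixes \<kappa> :: "'c::comm_ring_1 \<Rightarrow> 'r::comm_ring_1"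
  assumes \<kappa>: "unital_ring_hom \<kappa>"
begin

lemma lext_zero: "lext \<kappa> \<phi> 0 = 0"
  by (simp add: lext_def)

lemma lext_add: "lext \<kappa> \<phi> (f + g) = lext \<kappa> \<phi> f + lext \<kappa> \<phi> g"
proof -
  let ?S = "Poly_Mapping.keys f \<union> Poly_Mapping.keys g"
  have "Poly_Mapping.keys (f + g) \<subseteq> ?S" by (rule keys_add)
  then show ?thesis
    using \<kappa> by (simp add: lext_superset[OF \<kappa>, of ?S] lookup_add sum.distrib unital_ring_hom_def
        distrib_right)
qed

lemma lext_single: "lext \<kappa> \<phi> (Poly_Mapping.single m c) = \<kappa> c * \<phi> m"
  using \<kappa> by (cases "c = 0") (simp_all add: lext_def unital_ring_hom_zero)

lemma lext_uminus: "lext \<kappa> \<phi> (- f) = - lext \<kappa> \<phi> f"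
  using lext_add[of \<phi> f "- f"] by (simp add: lext_zero eq_neg_iff_add_eq_0 add.commute)

lemma lext_diff: "lext \<kappa> \<phi> (f - g) = lext \<kappa> \<phi> f - lext \<kappa> \<phi> g"
  using lext_add[of \<phi> f "- g"] by (simp add: lext_uminus)

lemma lext_sum: "lext \<kappa> \<phi> (sum h A) = (\<Sum>a\<in>A. lext \<kappa> \<phi> (h a))"
  by (induction A rule: infinite_finite_induct) (simp_all add: lext_zero lext_add)

lemma lext_scale:
  fixes f :: "'m::comm_monoid_add \<Rightarrow>\<^sub>0 'c"
  shows "lext \<kappa> \<phi> (Poly_Mapping.single 0 c * f) = \<kappa> c * lext \<kappa> \<phi> f"
  using \<kappa> by (induction f rule: poly_mapping_linear_induct)
    (simp_all add: lext_zero lext_add lext_single distrib_left mult_single unital_ring_hom_def mult.assoc)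

lemma lext_mult:
  fixes f :: "'m::comm_monoid_add \<Rightarrow>\<^sub>0 'c"
  assumes "\<And>m n. \<phi> (m + n) = \<phi> m * \<phi> n"
  shows "lext \<kappa> \<phi> (f * g) = lext \<kappa> \<phi> f * lext \<kappa> \<phi> g"
proof (induction f rule: poly_mapping_linear_induct)
  case (add m c f)
  have "lext \<kappa> \<phi> (Poly_Mapping.single m c * g) = \<kappa> c * \<phi> m * lext \<kappa> \<phi> g"
    using \<kappa> by (induction g rule: poly_mapping_linear_induct)
      (simp_all add: lext_zero lext_add lext_single distrib_left mult_single unital_ring_hom_def
        assms mult_ac)
  with add show ?case
    by (simp add: lext_add lext_single distrib_right)
qed (simp add: lext_zero)

text \<open>The Leibniz rule is relative to the homomorphism induced by \<phi>; checking it on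
  monomials suffices by bilinearity. \<open>derivation_lext\<close> is the case where that
  homomorphism is the identity.\<close>

lemma lext_derivation:
  fixes f :: "'m::comm_monoid_add \<Rightarrow>\<^sub>0 'c"
  assumes "\<And>m n. d (m + n) = d m * \<phi> n + \<phi> m * d n" and "\<And>m n. \<phi> (m + n) = \<phi> m * \<phi> n"
  shows "lext \<kappa> d (f * g) = lext \<kappa> d f * lext \<kappa> \<phi> g + lext \<kappa> \<phi> f * lext \<kappa> d g"
proof (induction f rule: poly_mapping_linear_induct)
  case (add m c f)
  have "lext \<kappa> d (Poly_Mapping.single m c * g) = \<kappa> c * d m * lext \<kappa> \<phi> g + \<kappa> c * \<phi> m * lext \<kappa> d g"
    using \<kappa> by (induction g rule: poly_mapping_linear_induct)
      (simp_all add: lext_zero lext_add lext_single distrib_left mult_single unital_ring_hom_def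
        assms algebra_simps)
  with add show ?case
    by (simp add: lext_add lext_single algebra_simps)
qed (simp add: lext_zero)

end

lemma lext_monomials: "lext cst (\<lambda>m. Poly_Mapping.single m 1) f = f"
  by (induction f rule: poly_mapping_linear_induct)
    (simp_all add: unital_ring_hom_cst lext_zero lext_add lext_single mult_single)

section \<open>Derivations of monoid algebras\<close>

definition derivation :: "(('m::comm_monoid_add \<Rightarrow>\<^sub>0 complex) \<Rightarrow> ('m \<Rightarrow>\<^sub>0 complex)) \<Rightarrow> bool" where
  "derivation D \<longleftrightarrow> (\<forall>f g. D (f + g) = D f + D g) \<and> (\<forall>c f. D (cst c * f) = cst c * D f)
    \<and> (\<forall>f g. D (f * g) = D f * g + f * D g)"

lemma derivation_lext:
  assumes "\<And>m n. d (m + n) = d m * Poly_Mapping.single n 1 + Poly_Mapping.single m 1 * d n"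
  shows "derivation (lext cst d)"
  unfolding derivation_def
  using lext_derivation[where \<phi> = "\<lambda>m. Poly_Mapping.single m 1", OF unital_ring_hom_cst assms]
    lext_add[OF unital_ring_hom_cst, of d] lext_scale[OF unital_ring_hom_cst, of d]
  by (simp only: mult_single lext_monomials mult_1_left) blast

context
  fixes D :: "('m::comm_monoid_add \<Rightarrow>\<^sub>0 complex) \<Rightarrow> ('m \<Rightarrow>\<^sub>0 complex)"
  assumes D: "derivation D"
begin

lemma derivation_add: "D (f + g) = D f + D g"
  and derivation_scale: "D (cst c * f) = cst c * D f"
  and derivation_mult: "D (f * g) = D f * g + f * D g"
  using D unfolding derivation_def by blast+

lemma derivation_zero: "D 0 = 0"
  using derivation_add[of 0 0] by simp

lemma derivation_one: "D 1 = 0"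
  using derivation_mult[of 1 1] by simp

lemma derivation_uminus: "D (- f) = - D f"
  using derivation_add[of f "- f"] by (simp add: derivation_zero eq_neg_iff_add_eq_0 add.commute)

lemma derivation_diff: "D (f - g) = D f - D g"
  using derivation_add[of f "- g"] by (simp add: derivation_uminus)

lemma derivation_sum: "D (sum h A) = (\<Sum>a\<in>A. D (h a))"
  by (induction A rule: infinite_finite_induct) (simp_all add: derivation_zero derivation_add)

lemma derivation_power_zero: "D f = 0 \<Longrightarrow> D (f ^ n) = 0"
  by (induction n) (simp_all add: derivation_one derivation_mult)

lemma funpow_derivation_add: "(D ^^ n) (f + g) = (D ^^ n) f + (D ^^ n) g"
  by (induction n) (simp_all add: derivation_add)

lemma funpow_derivation_scale: "(D ^^ n) (cst c * f) = cst c * (D ^^ n) f"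
  by (induction n) (simp_all add: derivation_scale)

lemma funpow_derivation_zero: "(D ^^ n) 0 = 0"
  by (induction n) (simp_all add: derivation_zero)

end

section \<open>Associativity of the Rankin--Cohen product\<close>

text \<open>The weights are free complex parameters, not read off from \<open>f\<close> and
  \<open>g\<close>. Hence k + vp can be inserted later, and no grading enters the proof of
  associativity.\<close>

definition rc :: "(('m::comm_monoid_add \<Rightarrow>\<^sub>0 complex) \<Rightarrow> ('m \<Rightarrow>\<^sub>0 complex)) \<Rightarrow> complex \<Rightarrow> complex
    \<Rightarrow> nat \<Rightarrow> ('m \<Rightarrow>\<^sub>0 complex) \<Rightarrow> ('m \<Rightarrow>\<^sub>0 complex) \<Rightarrow> ('m \<Rightarrow>\<^sub>0 complex)" where
  "rc D k l n f g = (\<Sum>r\<le>n.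
       cst ((-1)^r * ((k + of_nat n - 1) gchoose (n - r)) * ((l + of_nat n - 1) gchoose r))
       * (D ^^ r) f * (D ^^ (n - r)) g)"

text \<open>The symbols p_i and q_i stand for the derivatives in X and in Y of the i-th of three functions
  F_i = Y^(-k_i) f_i(X/Y).\<close>
type_synonym expo6 = "nat \<times> nat \<times> nat \<times> nat \<times> nat \<times> nat"

definition p1 :: "expo6 \<Rightarrow>\<^sub>0 complex" where "p1 = Poly_Mapping.single (1,0,0,0,0,0) 1"
definition q1 :: "expo6 \<Rightarrow>\<^sub>0 complex" where "q1 = Poly_Mapping.single (0,1,0,0,0,0) 1"
definition p2 :: "expo6 \<Rightarrow>\<^sub>0 complex" where "p2 = Poly_Mapping.single (0,0,1,0,0,0) 1"
definition q2 :: "expo6 \<Rightarrow>\<^sub>0 complex" where "q2 = Poly_Mapping.single (0,0,0,1,0,0) 1"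
definition p3 :: "expo6 \<Rightarrow>\<^sub>0 complex" where "p3 = Poly_Mapping.single (0,0,0,0,1,0) 1"
definition q3 :: "expo6 \<Rightarrow>\<^sub>0 complex" where "q3 = Poly_Mapping.single (0,0,0,0,0,1) 1"

lemmas symbol_defs = p1_def q1_def p2_def q2_def p3_def q3_def

definition "w12 = p1 * q2 - q1 * p2"
definition "w13 = p1 * q3 - q1 * p3"
definition "w23 = p2 * q3 - q2 * p3"

lemma symbol_power:
  "p1 ^ n = Poly_Mapping.single (n,0,0,0,0,0) 1" "q1 ^ n = Poly_Mapping.single (0,n,0,0,0,0) 1"
  "p2 ^ n = Poly_Mapping.single (0,0,n,0,0,0) 1" "q2 ^ n = Poly_Mapping.single (0,0,0,n,0,0) 1"
  "p3 ^ n = Poly_Mapping.single (0,0,0,0,n,0) 1" "q3 ^ n = Poly_Mapping.single (0,0,0,0,0,n) 1"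
  by (induction n; simp only: power_0 power_Suc symbol_defs mult_single add_Pair add_0_left add_0_right plus_1_eq_Suc
      mult_1_left zero_prod_def[symmetric] single_one)+

text \<open>The derivation q_i \<mapsto> p_i, p_i \<mapsto> 0.  It kills w_ij: this is the invariance of the
  transvectants under the shear X \<mapsto> X + cY.\<close>
fun xder_mono :: "expo6 \<Rightarrow> expo6 \<Rightarrow>\<^sub>0 complex" where
  "xder_mono (a,b,c,d,e,f) =
     Poly_Mapping.single (a+1,b-1,c,d,e,f) (of_nat b) + Poly_Mapping.single (a,b,c+1,d-1,e,f) (of_nat d)
     + Poly_Mapping.single (a,b,c,d,e+1,f-1) (of_nat f)"

definition "xder = lext cst xder_mono"

lemma derivation_xder: "derivation xder"
  unfolding xder_def
proof (rule derivation_lext, clarify)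
  fix a b c d e f a' b' c' d' e' f' :: nat
  let ?s = "Poly_Mapping.single :: expo6 \<Rightarrow> complex \<Rightarrow> expo6 \<Rightarrow>\<^sub>0 complex"
  let ?m = "(a,b,c,d,e,f)" and ?m' = "(a',b',c',d',e',f')"
  \<comment> \<open>Leibniz rule for a single exponent. Truncated subtraction does no harm: wherever
    it truncates, the coefficient is 0.\<close>
  have split: "?s (h (i + j - 1)) (of_nat (i + j)) = ?s (h (i - 1 + j)) (of_nat i) + ?s (h (i + (j - 1))) (of_nat j)"
    for i j :: nat and h
    by (cases i; cases j) (simp_all flip: single_add)
  have 1: "?s (a + a' + 1, b + b' - 1, c + c', d + d', e + e', f + f') (of_nat (b + b')) =
      ?s (a+1,b-1,c,d,e,f) (of_nat b) * ?s ?m' 1 + ?s ?m 1 * ?s (a'+1,b'-1,c',d',e',f') (of_nat b')"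
    using split[of "\<lambda>b. (a + a' + 1, b, c + c', d + d', e + e', f + f')" b b']
    by (simp only: mult_single add_Pair mult_1_left mult_1_right add_ac)
  have 2: "?s (a + a', b + b', c + c' + 1, d + d' - 1, e + e', f + f') (of_nat (d + d')) =
      ?s (a,b,c+1,d-1,e,f) (of_nat d) * ?s ?m' 1 + ?s ?m 1 * ?s (a',b',c'+1,d'-1,e',f') (of_nat d')"
    using split[of "\<lambda>d. (a + a', b + b', c + c' + 1, d, e + e', f + f')" d d']
    by (simp only: mult_single add_Pair mult_1_left mult_1_right add_ac)
  have 3: "?s (a + a', b + b', c + c', d + d', e + e' + 1, f + f' - 1) (of_nat (f + f')) =
      ?s (a,b,c,d,e+1,f-1) (of_nat f) * ?s ?m' 1 + ?s ?m 1 * ?s (a',b',c',d',e'+1,f'-1) (of_nat f')"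
    using split[of "\<lambda>f. (a + a', b + b', c + c', d + d', e + e' + 1, f)" f f']
    by (simp only: mult_single add_Pair mult_1_left mult_1_right add_ac)
  show "xder_mono (?m + ?m') = xder_mono ?m * ?s ?m' 1 + ?s ?m 1 * xder_mono ?m'"
    unfolding add_Pair xder_mono.simps 1 2 3 distrib_left distrib_right by (simp only: add_ac)
qed

lemma xder_single: "xder (Poly_Mapping.single m c) = cst c * xder_mono m"
  by (simp add: xder_def lext_single unital_ring_hom_cst)

lemma xder_symbols: "xder p1 = 0" "xder q1 = p1" "xder p2 = 0" "xder q2 = p2"
  by (simp_all add: symbol_defs xder_single mult_single)

lemma xder_w12: "xder w12 = 0"
  by (simp add: w12_def derivation_diff[OF derivation_xder] derivation_mult[OF derivation_xder]
      xder_symbols)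

section \<open>Homogeneous symbols in the first two pairs of variables\<close>

definition expo12 :: "nat \<Rightarrow> expo6 set" where
  "expo12 n = {(a,b,c,d,0,0) |a b c d. a + b + c + d = n}"

definition deg12 :: "nat \<Rightarrow> (expo6 \<Rightarrow>\<^sub>0 complex) set" where
  "deg12 n = {P. Poly_Mapping.keys P \<subseteq> expo12 n}"

lemma expo12_add:
  assumes "x \<in> expo12 m" "y \<in> expo12 n"
  shows "x + y \<in> expo12 (m + n)"
proof -
  from assms obtain a b c d a' b' c' d' where "x = (a,b,c,d,0,0)" "a + b + c + d = m"
    and "y = (a',b',c',d',0,0)" "a' + b' + c' + d' = n"
    unfolding expo12_def by blast
  then show ?thesis by (simp add: expo12_def)
qed

lemma deg12_add: "P \<in> deg12 n \<Longrightarrow> Q \<in> deg12 n \<Longrightarrow> P + Q \<in> deg12 n"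
  unfolding deg12_def mem_Collect_eq using keys_add[of P Q] by (meson le_sup_iff subset_trans sup_least)

lemma deg12_diff: "P \<in> deg12 n \<Longrightarrow> Q \<in> deg12 n \<Longrightarrow> P - Q \<in> deg12 n"
  unfolding deg12_def mem_Collect_eq using keys_diff[of P Q] by (meson le_sup_iff subset_trans sup_least)

lemma deg12_mult:
  assumes "P \<in> deg12 m" "Q \<in> deg12 n"
  shows "P * Q \<in> deg12 (m + n)"
  unfolding deg12_def mem_Collect_eq
proof
  fix z assume "z \<in> Poly_Mapping.keys (P * Q)"
  then obtain x y where "z = x + y" "x \<in> Poly_Mapping.keys P" "y \<in> Poly_Mapping.keys Q"
    using keys_mult[of P Q] by blast
  then show "z \<in> expo12 (m + n)"
    using assms unfolding deg12_def by (simp add: expo12_add subset_eq)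
qed

lemma deg12_one: "1 \<in> deg12 0"
  by (simp add: deg12_def expo12_def zero_prod_def)

lemma deg12_power: "P \<in> deg12 m \<Longrightarrow> P ^ n \<in> deg12 (n * m)"
  by (induction n) (simp_all add: deg12_one deg12_mult)

lemma deg12_symbols: "p1 \<in> deg12 1" "q1 \<in> deg12 1" "p2 \<in> deg12 1" "q2 \<in> deg12 1"
  by (simp_all add: deg12_def expo12_def symbol_defs)

lemma deg12_w12: "w12 \<in> deg12 2"
  using deg12_diff[OF deg12_mult[OF deg12_symbols(1,4)] deg12_mult[OF deg12_symbols(2,3)]]
  by (simp add: w12_def numeral_2_eq_2)

lemma deg12_induct [consumes 1, case_names zero monomial]:
  assumes "P \<in> deg12 n" and "R 0"
    and "\<And>a b c d z P. a + b + c + d = n \<Longrightarrow> R P \<Longrightarrow> R (Poly_Mapping.single (a,b,c,d,0,0) z + P)"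
  shows "R P"
proof -
  have "Poly_Mapping.keys P \<subseteq> expo12 n \<Longrightarrow> R P"
  proof (induction P rule: update_induct)
    case const
    show ?case by (fact assms(2))
  next
    case (update P m z)
    from update.prems update.hyps have "m \<in> expo12 n" and P: "Poly_Mapping.keys P \<subseteq> expo12 n"
      by (simp_all add: keys_update)
    then obtain a b c d where m: "m = (a,b,c,d,0,0)" and n: "a + b + c + d = n"
      unfolding expo12_def by blast
    show ?case
      unfolding update_conv_add[OF update.hyps(1)] unfolding m by (rule assms(3)[OF n update.IH[OF P]])
  qed
  then show ?thesis using assms(1) by (simp add: deg12_def)
qed

text \<open>With f of weight k corresponding to F = Y^(-k) f(X/Y), this is the value at (X, Y) = (0, 1)
  of the partial derivative of F, a times in X and b times in Y.\<close>
definition jet :: "(('m::comm_monoid_add \<Rightarrow>\<^sub>0 complex) \<Rightarrow> ('m \<Rightarrow>\<^sub>0 complex)) \<Rightarrow> complex \<Rightarrow> ('m \<Rightarrow>\<^sub>0 complex) \<Rightarrow> nat \<Rightarrow> nat \<Rightarrow> 'm \<Rightarrow>\<^sub>0 complex" where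
  "jet D k f a b = cst ((-1)^b * pochhammer (k + of_nat a) b) * (D ^^ a) f"

text \<open>A polynomial in the symbols acts as a constant coefficient differential operator on F_1
  F_2 F_3, each factor in its own variables, and all are then evaluated at (0, 1). Composition of
  operators becomes multiplication of polynomials.\<close>

definition ev :: "(('m::comm_monoid_add \<Rightarrow>\<^sub>0 complex) \<Rightarrow> ('m \<Rightarrow>\<^sub>0 complex)) \<Rightarrow> complex \<Rightarrow> complex \<Rightarrow> complex \<Rightarrow> ('m \<Rightarrow>\<^sub>0 complex) \<Rightarrow> ('m \<Rightarrow>\<^sub>0 complex) \<Rightarrow> ('m \<Rightarrow>\<^sub>0 complex)
    \<Rightarrow> (expo6 \<Rightarrow>\<^sub>0 complex) \<Rightarrow> ('m \<Rightarrow>\<^sub>0 complex)" where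
  "ev D k l m f g h = lext cst (\<lambda>(a1,b1,a2,b2,a3,b3). jet D k f a1 b1 * jet D l g a2 b2 * jet D m h a3 b3)"

lemma cst_minus_one_power: "cst ((-1) ^ n) = (-1) ^ n"
  by (induction n) (simp_all add: cst_mult single_uminus)

section \<open>Symbols acting on jets\<close>

context
  fixes D :: "('m::comm_monoid_add \<Rightarrow>\<^sub>0 complex) \<Rightarrow> ('m \<Rightarrow>\<^sub>0 complex)"
  assumes D: "derivation D"
begin

lemmas ev_linear = lext_zero[OF unital_ring_hom_cst] lext_add[OF unital_ring_hom_cst]
  lext_single[OF unital_ring_hom_cst] lext_diff[OF unital_ring_hom_cst]
  lext_scale[OF unital_ring_hom_cst] lext_sum[OF unital_ring_hom_cst]

lemma jet_Suc_right: "jet D k f a (Suc b) = - cst (k + of_nat (a + b)) * jet D k f a b"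
proof -
  have "(-1) ^ Suc b * pochhammer (k + of_nat a) (Suc b)
      = - (k + of_nat (a + b)) * ((-1) ^ b * pochhammer (k + of_nat a) b)"
    by (simp add: pochhammer_Suc algebra_simps)
  then show ?thesis
    unfolding jet_def single_uminus[symmetric] cst_mult_left by (rule arg_cong)
qed

text \<open>\<open>D\<close> moves the base point, replacing F(X, Y) by F(X + tY, Y), so it inserts
  the operator Y d/dX. Moving b derivatives in Y past the factor Y produces the second term.\<close>

lemma derivation_jet:
  "D (jet D k f a b) = jet D k f (Suc a) b + cst (of_nat b) * jet D k f (Suc a) (b - 1)"
proof (cases b)
  case 0
  then show ?thesis by (simp add: jet_def derivation_scale[OF D])
next
  case (Suc c)
  have "pochhammer (k + of_nat a) (Suc c) + of_nat (Suc c) * pochhammer (k + of_nat (Suc a)) c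
      = pochhammer (k + of_nat (Suc a)) (Suc c)"
    using pochhammer_rec[of "k + of_nat a" c] pochhammer_Suc[of "k + of_nat (Suc a)" c]
    by (simp add: algebra_simps)
  note eq = this
  then have "(-1) ^ Suc c * pochhammer (k + of_nat a) (Suc c)
     = (-1) ^ Suc c * pochhammer (k + of_nat (Suc a)) (Suc c)
        + of_nat (Suc c) * ((-1) ^ c * pochhammer (k + of_nat (Suc a)) c)"
    unfolding eq[symmetric] power_Suc by algebra
  then show ?thesis
    unfolding jet_def Suc derivation_scale[OF D] cst_mult_left
    by (simp only: single_add distrib_right diff_Suc_1 funpow.simps o_apply)
qed

lemma ev_monomial: "ev D k l m f g h (Poly_Mapping.single (a1,b1,a2,b2,a3,b3) c)
    = cst c * (jet D k f a1 b1 * jet D l g a2 b2 * jet D m h a3 b3)"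
  by (simp add: ev_def ev_linear)

text \<open>Euler's relation: F_1 F_2 is homogeneous of degree -(k + l), every derivative in X or Y
  lowers the degree by one, and at (0, 1) the derivative in Y is the Euler operator.\<close>

lemma ev_weight:
  assumes "P \<in> deg12 n"
  shows "ev D k l m f g h ((q1 + q2) * P) = - cst (k + l + of_nat n) * ev D k l m f g h P"
  using assms
proof (induction rule: deg12_induct)
  case (monomial a b c d z P)
  have "ev D k l m f g h ((q1 + q2) * Poly_Mapping.single (a,b,c,d,0,0) z)
     = cst z * (jet D k f a (Suc b) * jet D l g c d * jet D m h 0 0)
       + cst z * (jet D k f a b * jet D l g c (Suc d) * jet D m h 0 0)"
    by (simp add: symbol_defs distrib_right mult_single ev_def ev_linear)
  also have "\<dots> = - (cst (k + of_nat (a + b)) + cst (l + of_nat (c + d))) *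
      (cst z * (jet D k f a b * jet D l g c d * jet D m h 0 0))"
    unfolding jet_Suc_right
    by (simp only: distrib_left distrib_right minus_add_distrib mult_minus_left mult_minus_right mult_ac)
  also have "cst (k + of_nat (a + b)) + cst (l + of_nat (c + d)) = cst (k + l + of_nat n)"
    unfolding monomial(1)[symmetric] single_add[symmetric] by (simp add: algebra_simps)
  finally show ?case
    using monomial(2) by (simp only: distrib_left ev_def ev_linear)
       (simp add: ev_monomial[unfolded ev_def])
qed (simp add: ev_def ev_linear)

lemma jet_one: "jet D m 1 0 0 = 1" "jet D m 1 (Suc a) b = 0"
  by (simp_all only: jet_def funpow_Suc_right o_apply derivation_one[OF D] funpow_derivation_zero[OF D]
      pochhammer_0 power_0 funpow_0 id_apply mult_1_left mult_zero_right single_one)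

text \<open>On symbols, \<open>D\<close> acts as multiplication by p1 + p2 plus the correction
  \<open>xder\<close>, which collects the second terms of \<open>derivation_jet\<close>. The third
  argument 1 has zeroth jet 1, so the evaluation only sees the first two slots.\<close>

lemma ev_derivation:
  assumes "P \<in> deg12 n"
  shows "ev D k l m f g 1 ((p1 + p2) * P) = D (ev D k l m f g 1 P) - ev D k l m f g 1 (xder P)"
  using assms
proof (induction rule: deg12_induct)
  case (monomial a b c d z P)
  let ?m = "Poly_Mapping.single (a,b,c,d,0,0) z"
  have 1: "ev D k l m f g 1 ((p1 + p2) * ?m)
     = cst z * (jet D k f (Suc a) b * jet D l g c d) + cst z * (jet D k f a b * jet D l g (Suc c) d)"
    by (simp add: symbol_defs distrib_right mult_single ev_def ev_linear jet_one)
  have 2: "ev D k l m f g 1 (xder ?m)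
     = cst z * (cst (of_nat b) * (jet D k f (Suc a) (b - 1) * jet D l g c d))
      + cst z * (cst (of_nat d) * (jet D k f a b * jet D l g (Suc c) (d - 1)))"
    by (simp add: xder_single ev_def ev_linear jet_one distrib_left del: single_of_nat)
  have 3: "D (ev D k l m f g 1 ?m) = cst z * ((jet D k f (Suc a) b + cst (of_nat b) * jet D k f (Suc a) (b - 1)) * jet D l g c d
      + jet D k f a b * (jet D l g (Suc c) d + cst (of_nat d) * jet D l g (Suc c) (d - 1)))"
    unfolding ev_monomial jet_one mult_1_right derivation_scale[OF D]
    unfolding derivation_mult[OF D] derivation_jet by (rule refl)
  have "ev D k l m f g 1 ((p1 + p2) * ?m) = D (ev D k l m f g 1 ?m) - ev D k l m f g 1 (xder ?m)"
    unfolding 1 2 3 by (simp only: algebra_simps)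
  then show ?case
    using monomial(2)
    by (simp add: distrib_left ev_def ev_linear derivation_add[OF D] derivation_add[OF derivation_xder])
qed (simp add: ev_def ev_linear derivation_zero[OF D] derivation_zero[OF derivation_xder])

text \<open>Each factor q1 + q2 raises the degree, so iterating Euler's relation builds the same
  rising factorial as in \<open>jet\<close>.\<close>

lemma ev_q_power:
  assumes "P \<in> deg12 n"
  shows "ev D k l m f g h ((q1 + q2) ^ b * P) = cst ((-1) ^ b * pochhammer (k + l + of_nat n) b) * ev D k l m f g h P"
proof (induction b)
  case (Suc b)
  have "(q1 + q2) ^ b * P \<in> deg12 (b + n)"
    using deg12_mult[OF deg12_power[OF deg12_add[OF deg12_symbols(2,4)]] assms] by simp
  note * = ev_weight[OF this, of k l m f g h, folded mult.assoc power_Suc]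
  have "(-1) ^ Suc b * pochhammer (k + l + of_nat n) (Suc b)
      = - (k + l + of_nat (b + n)) * ((-1) ^ b * pochhammer (k + l + of_nat n) b)"
    by (simp add: pochhammer_Suc algebra_simps)
  then show ?case
    unfolding * Suc single_uminus[symmetric] cst_mult_left by (simp only:)
qed simp

lemma ev_p_power:
  assumes "P \<in> deg12 n" "xder P = 0"
  shows "ev D k l m f g 1 ((p1 + p2) ^ a * P) = (D ^^ a) (ev D k l m f g 1 P)"
proof (induction a)
  case (Suc a)
  have "(p1 + p2) ^ a * P \<in> deg12 (a + n)"
    using deg12_mult[OF deg12_power[OF deg12_add[OF deg12_symbols(1,3)]] assms(1)] by simp
  note * = ev_derivation[OF this, of k l m f g, folded mult.assoc power_Suc]
  have "xder ((p1 + p2) ^ a) = 0"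
    by (simp add: derivation_power_zero[OF derivation_xder] derivation_add[OF derivation_xder] xder_symbols)
  then have "xder ((p1 + p2) ^ a * P) = 0"
    by (simp add: derivation_mult[OF derivation_xder] assms(2))
  then show ?case
    unfolding * Suc by (simp add: ev_def ev_linear)
qed simp

lemma ev_third:
  assumes "P \<in> deg12 n"
  shows "ev D k l m f g h (P * (p3 ^ c * q3 ^ d)) = ev D k l m f g 1 P * jet D m h c d"
  using assms
proof (induction rule: deg12_induct)
  case (monomial a b c' d' z P)
  have "Poly_Mapping.single (a,b,c',d',0,0) z * (p3 ^ c * q3 ^ d) = Poly_Mapping.single (a,b,c',d',c,d) z"
    by (simp add: symbol_power mult_single)
  then have "ev D k l m f g h (Poly_Mapping.single (a,b,c',d',0,0) z * (p3 ^ c * q3 ^ d))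
      = ev D k l m f g 1 (Poly_Mapping.single (a,b,c',d',0,0) z) * jet D m h c d"
    by (simp only: ev_monomial jet_one mult_1_right mult.assoc)
  then show ?case
    using monomial(2) by (simp only: distrib_right ev_def ev_linear)
qed (simp add: ev_def ev_linear)

lemma ev_sum: "ev D k l m f g h (sum P A) = (\<Sum>a\<in>A. ev D k l m f g h (P a))"
  and ev_scale: "ev D k l m f g h (cst c * Q) = cst c * ev D k l m f g h Q"
  and ev_add: "ev D k l m f g h (Q + R) = ev D k l m f g h Q + ev D k l m f g h R"
  by (simp_all only: ev_def ev_linear)

text \<open>The coefficient (k + n - 1 choose n - r) is the rising factorial of k + r of length n -
  r over (n - r)!, so n! turns the two denominators into a binomial coefficient. The summation index
  is reversed: on the right r counts the derivatives of F_1 in Y, as in the expansion of (p1 q2 - q1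
  p2)^n.\<close>

lemma rc_jet:
  "cst (fact n) * rc D k l n f g = (\<Sum>r\<le>n. cst (of_nat (n choose r) * (-1) ^ r) * jet D k f (n - r) r * jet D l g r (n - r))"
proof -
  have "cst (fact n) * (cst ((-1)^r * ((k + of_nat n - 1) gchoose (n - r)) * ((l + of_nat n - 1) gchoose r))
       * (D ^^ r) f * (D ^^ (n - r)) g)
     = cst (of_nat (n choose (n - r)) * (-1) ^ (n - r)) * jet D k f (n - (n - r)) (n - r) * jet D l g (n - r) (n - (n - r))"
    if "r \<le> n" for r
  proof -
    have g: "a + of_nat n - 1 gchoose i = pochhammer (a + of_nat (n - i)) i / fact i" if "i \<le> n" for a :: complex and i
      using that by (simp add: gbinomial_pochhammer' of_nat_diff algebra_simps)
    have s: "(-1) ^ (n - r) * (-1) ^ (n - r) = (1::complex)"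
      by (simp flip: power_add mult_2)
    have n: "fact n = of_nat (n choose (n - r)) * (fact (n - r) * fact r :: complex)"
      using that by (simp add: binomial_fact)
    have e: "fact n * ((-1)^r * ((k + of_nat n - 1) gchoose (n - r)) * ((l + of_nat n - 1) gchoose r))
      = of_nat (n choose (n - r)) * (-1) ^ (n - r) * ((-1) ^ (n - r) * pochhammer (k + of_nat r) (n - r))
        * ((-1) ^ r * pochhammer (l + of_nat (n - r)) r)" (is "_ = ?c")
    proof -
      have "?c = of_nat (n choose (n - r)) * ((-1) ^ (n - r) * (-1) ^ (n - r)) * (-1) ^ r
          * (pochhammer (k + of_nat r) (n - r) * pochhammer (l + of_nat (n - r)) r)"
        by (simp only: mult_ac)
      then show ?thesis
        unfolding s n using that by (simp add: g)
    qed
    show ?thesis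
      using arg_cong[OF e, of "\<lambda>x. cst x * ((D ^^ r) f * (D ^^ (n - r)) g)"]
      by (simp only: jet_def diff_diff_cancel[OF that] cst_mult mult_ac)
  qed
  then have "cst (fact n) * rc D k l n f g = (\<Sum>r\<le>n. cst (of_nat (n choose (n - r)) * (-1) ^ (n - r)) * jet D k f (n - (n - r)) (n - r) * jet D l g (n - r) (n - (n - r)))"
    unfolding rc_def sum_distrib_left by (intro sum.cong) auto
  also have "\<dots> = (\<Sum>r\<le>n. cst (of_nat (n choose r) * (-1) ^ r) * jet D k f (n - r) r * jet D l g r (n - r))"
    by (intro sum.reindex_bij_witness[of _ "\<lambda>r. n - r" "\<lambda>r. n - r"]) auto
  finally show ?thesis .
qed

lemma ev_w12_power: "ev D k l m f g 1 (w12 ^ n) = cst (fact n) * rc D k l n f g"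
proof -
  have "w12 ^ n = (- (q1 * p2) + p1 * q2) ^ n"
    by (simp add: w12_def)
  also have "\<dots> = (\<Sum>r\<le>n. Poly_Mapping.single (n - r, r, r, n - r, 0, 0) (of_nat (n choose r) * (-1) ^ r))"
    unfolding binomial_ring
  proof (rule sum.cong)
    fix r
    have "of_nat (n choose r) * (- (q1 * p2)) ^ r * (p1 * q2) ^ (n - r)
        = cst (of_nat (n choose r)) * (cst ((-1) ^ r) * (q1 ^ r * p2 ^ r * (p1 ^ (n - r) * q2 ^ (n - r))))"
      unfolding power_minus[of "q1 * p2"] power_mult_distrib
      by (simp only: single_of_nat cst_minus_one_power mult.assoc)
    then show "of_nat (n choose r) * (- (q1 * p2)) ^ r * (p1 * q2) ^ (n - r)
        = Poly_Mapping.single (n - r, r, r, n - r, 0, 0) (of_nat (n choose r) * (-1) ^ r)"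
      by (simp only: symbol_power mult_single add_Pair add_0_left add_0_right mult_1_left mult_1_right)
  qed simp
  finally have w: "w12 ^ n = (\<Sum>r\<le>n. Poly_Mapping.single (n - r, r, r, n - r, 0, 0) (of_nat (n choose r) * (-1) ^ r))" .
  show ?thesis
    unfolding w rc_jet ev_sum ev_monomial jet_one by (simp only: mult_1_right mult.assoc)
qed

lemma jet_scale: "jet D k (cst c * f) a b = cst c * jet D k f a b"
  unfolding jet_def funpow_derivation_scale[OF D] by (simp only: mult.left_commute)

text \<open>The symbol w12^r has degree 2r and is killed by \<open>xder\<close>. Hence multiplying
  it by powers of p1 + p2 and q1 + q2 evaluates to the jets of r! times the inner bracket, taken
  with weight k + l + 2r. This is what lets the inner bracket be an argument of the outer
  one.\<close>

lemma rc_rc: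
  "cst (fact r) * (cst (fact s) * rc D (k + l + 2 * of_nat r) m s (rc D k l r f g) h)
   = ev D k l m f g h (w12 ^ r * (w13 + w23) ^ s)"
proof -
  let ?k = "k + l + 2 * of_nat r" and ?F = "rc D k l r f g"
  have summand: "cst (fact r) * (cst (of_nat (s choose j) * (-1) ^ j) * jet D ?k ?F (s - j) j * jet D m h j (s - j))
      = cst (of_nat (s choose j) * (-1) ^ j) *
        ev D k l m f g h ((q1 + q2) ^ j * ((p1 + p2) ^ (s - j) * w12 ^ r) * (p3 ^ j * q3 ^ (s - j)))"
    for j
  proof -
    have w: "w12 ^ r \<in> deg12 (r * 2)" "xder (w12 ^ r) = 0"
      using deg12_power[OF deg12_w12] derivation_power_zero[OF derivation_xder xder_w12] by blast+
    have p: "(p1 + p2) ^ (s - j) * w12 ^ r \<in> deg12 ((s - j) * 1 + r * 2)"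
      by (intro deg12_mult deg12_power deg12_add deg12_symbols w)
    have q: "(q1 + q2) ^ j * ((p1 + p2) ^ (s - j) * w12 ^ r) \<in> deg12 (j * 1 + ((s - j) * 1 + r * 2))"
      by (intro p deg12_mult deg12_power deg12_add deg12_symbols)
    \<comment> \<open>The s - j derivatives in X also count in the degree; this gives the shift by
      the first jet index in \<open>jet\<close>.\<close>
    have e: "k + l + of_nat ((s - j) * 1 + r * 2) = ?k + of_nat (s - j)"
      by simp
    have "ev D k l m f g 1 ((q1 + q2) ^ j * ((p1 + p2) ^ (s - j) * w12 ^ r)) = jet D ?k (cst (fact r) * ?F) (s - j) j"
      unfolding ev_q_power[OF p] ev_p_power[OF w] ev_w12_power e jet_def by (rule refl)
    then show ?thesis
      unfolding ev_third[OF q] jet_scale by (simp only: mult_ac)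
  qed
  \<comment> \<open>Derivatives of the product F_1 F_2 have the symbols p1 + p2 and q1 + q2, and w13
    + w23 pairs these with the third function.\<close>
  have "w13 + w23 = - ((q1 + q2) * p3) + (p1 + p2) * q3"
    by (simp add: w13_def w23_def algebra_simps)
  then have "w12 ^ r * (w13 + w23) ^ s = w12 ^ r * (- ((q1 + q2) * p3) + (p1 + p2) * q3) ^ s"
    by simp
  also have "\<dots> = (\<Sum>j\<le>s. cst (of_nat (s choose j) * (-1) ^ j) *
      ((q1 + q2) ^ j * ((p1 + p2) ^ (s - j) * w12 ^ r) * (p3 ^ j * q3 ^ (s - j))))"
    unfolding binomial_ring[of "- ((q1 + q2) * p3)"] sum_distrib_left
  proof (rule sum.cong)
    fix j
    show "w12 ^ r * (of_nat (s choose j) * (- ((q1 + q2) * p3)) ^ j * ((p1 + p2) * q3) ^ (s - j))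
      = cst (of_nat (s choose j) * (-1) ^ j) *
      ((q1 + q2) ^ j * ((p1 + p2) ^ (s - j) * w12 ^ r) * (p3 ^ j * q3 ^ (s - j)))"
      unfolding power_minus[of "(q1 + q2) * p3"] power_mult_distrib
      by (simp only: cst_mult cst_minus_one_power single_of_nat mult_ac)
  qed simp
  finally have w: "w12 ^ r * (w13 + w23) ^ s = (\<Sum>j\<le>s. cst (of_nat (s choose j) * (-1) ^ j) *
      ((q1 + q2) ^ j * ((p1 + p2) ^ (s - j) * w12 ^ r) * (p3 ^ j * q3 ^ (s - j))))" .
  show ?thesis
    unfolding w rc_jet sum_distrib_left summand ev_sum ev_scale ..
qed

lemma sum_rc_rc:
  "(\<Sum>r\<le>n. rc D (k + l + 2 * of_nat r) m (n - r) (rc D k l r f g) h)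
   = cst (1 / fact n) * ev D k l m f g h ((w12 + w13 + w23) ^ n)"
proof -
  have "(w12 + w13 + w23) ^ n = (\<Sum>r\<le>n. cst (of_nat (n choose r)) * (w12 ^ r * (w13 + w23) ^ (n - r)))"
    unfolding add.assoc binomial_ring[of w12] single_of_nat mult.assoc ..
  then have "cst (1 / fact n) * ev D k l m f g h ((w12 + w13 + w23) ^ n)
      = (\<Sum>r\<le>n. cst (1 / fact n * (of_nat (n choose r) * (fact r * fact (n - r)))) *
          rc D (k + l + 2 * of_nat r) m (n - r) (rc D k l r f g) h)"
    by (simp only: ev_sum ev_scale sum_distrib_left cst_mult rc_rc[symmetric] mult.assoc)
  also have "\<dots> = (\<Sum>r\<le>n. rc D (k + l + 2 * of_nat r) m (n - r) (rc D k l r f g) h)"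
  proof (rule sum.cong)
    fix r assume "r \<in> {..n}"
    then have "1 / fact n * (of_nat (n choose r) * (fact r * fact (n - r))) = (1::complex)"
      by (simp add: binomial_fact)
    then show "cst (1 / fact n * (of_nat (n choose r) * (fact r * fact (n - r)))) *
          rc D (k + l + 2 * of_nat r) m (n - r) (rc D k l r f g) h
        = rc D (k + l + 2 * of_nat r) m (n - r) (rc D k l r f g) h"
      by (simp only: single_one mult_1_left)
  qed simp
  finally show ?thesis ..
qed

lemma rc_scale_left: "rc D k l n (cst c * f) g = cst c * rc D k l n f g"
  unfolding rc_def funpow_derivation_scale[OF D] sum_distrib_left
  by (simp only: mult_ac)

lemma rc_scale_right: "rc D k l n f (cst c * g) = cst c * rc D k l n f g"
  unfolding rc_def funpow_derivation_scale[OF D] sum_distrib_left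
  by (simp only: mult_ac)

text \<open>Reversing the summation exchanges the two binomials and leaves the parity of n, just as
  w12^n does when its indices are exchanged.\<close>

lemma rc_commute: "rc D k l n f g = cst ((-1) ^ n) * rc D l k n g f"
proof -
  have "rc D k l n f g = (\<Sum>r\<le>n.
       cst ((-1)^(n - r) * ((k + of_nat n - 1) gchoose (n - (n - r))) * ((l + of_nat n - 1) gchoose (n - r)))
       * (D ^^ (n - r)) f * (D ^^ (n - (n - r))) g)"
    unfolding rc_def by (intro sum.reindex_bij_witness[of _ "\<lambda>r. n - r" "\<lambda>r. n - r"]) auto
  also have "\<dots> = cst ((-1) ^ n) * rc D l k n g f"
    unfolding rc_def sum_distrib_left
  proof (rule sum.cong)
    fix r assume "r \<in> {..n}"
    then have r: "n - (n - r) = r" and s: "(-1) ^ (n - r) = (-1) ^ n * (-1::complex) ^ r"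
      by (auto simp: minus_one_power_iff)
    show "cst ((-1)^(n - r) * ((k + of_nat n - 1) gchoose (n - (n - r))) * ((l + of_nat n - 1) gchoose (n - r)))
       * (D ^^ (n - r)) f * (D ^^ (n - (n - r))) g
       = cst ((-1) ^ n) * (cst ((-1)^r * ((l + of_nat n - 1) gchoose (n - r)) * ((k + of_nat n - 1) gchoose r))
       * (D ^^ r) g * (D ^^ (n - r)) f)"
      unfolding r s cst_mult by (simp only: mult_ac)
  qed simp
  finally show ?thesis .
qed

end

section \<open>Reversal of the three arguments and associativity\<close>

definition swap13 :: "(expo6 \<Rightarrow>\<^sub>0 complex) \<Rightarrow> (expo6 \<Rightarrow>\<^sub>0 complex)" where
  "swap13 = lext cst (\<lambda>(a,b,c,d,e,f). Poly_Mapping.single (e,f,c,d,a,b) 1)"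

lemma swap13_single: "swap13 (Poly_Mapping.single (a,b,c,d,e,f) z) = Poly_Mapping.single (e,f,c,d,a,b) z"
  by (simp add: swap13_def lext_single unital_ring_hom_cst mult_single)

lemma swap13_mult: "swap13 (P * Q) = swap13 P * swap13 Q"
  unfolding swap13_def
  by (rule lext_mult[OF unital_ring_hom_cst]) (simp add: mult_single split: prod.splits)

lemma swap13_add: "swap13 (P + Q) = swap13 P + swap13 Q"
  and swap13_diff: "swap13 (P - Q) = swap13 P - swap13 Q"
  by (simp_all add: swap13_def lext_add lext_diff unital_ring_hom_cst)

lemma swap13_power: "swap13 (P ^ n) = swap13 P ^ n"
proof (induction n)
  case 0
  then show ?case
    using swap13_single[of 0 0 0 0 0 0 1] by (simp flip: zero_prod_def)
qed (simp add: swap13_mult)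

lemma swap13_w: "swap13 (w12 + w13 + w23) = - (w12 + w13 + w23)"
proof -
  have "swap13 p1 = p3" "swap13 q1 = q3" "swap13 p2 = p2" "swap13 q2 = q2" "swap13 p3 = p1" "swap13 q3 = q1"
    by (simp_all add: symbol_defs swap13_single)
  then show ?thesis
    by (simp add: w12_def w13_def w23_def swap13_add swap13_diff swap13_mult)
qed

lemma ev_swap13:
  assumes D: "derivation D"
  shows "ev D m l k h g f P = ev D k l m f g h (swap13 P)"
proof (induction P rule: poly_mapping_linear_induct)
  case zero
  show ?case by (simp add: ev_def swap13_def lext_zero unital_ring_hom_cst)
next
  case (add x c P)
  obtain a b c' d e f' where x: "x = (a,b,c',d,e,f')" by (rule prod_cases6)
  show ?case
    unfolding ev_add[OF D] swap13_add add x swap13_single ev_monomial[OF D] by (simp only: mult_ac)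
qed

text \<open>Applying \<open>rc_commute\<close> to the inner and the outer bracket turns the
  right-nested sum into (-1)^n times the left-nested sum for h, g, f. By \<open>swap13_w\<close>,
  returning to the order f, g, h costs a second (-1)^n, and the signs cancel.\<close>

theorem rc_associative:
  assumes D: "derivation D"
  shows "(\<Sum>r\<le>n. rc D (k + l + 2 * of_nat r) m (n - r) (rc D k l r f g) h)
    = (\<Sum>r\<le>n. rc D k (l + m + 2 * of_nat r) (n - r) f (rc D l m r g h))"
proof -
  let ?W = "w12 + w13 + w23"
  have "(\<Sum>r\<le>n. rc D k (l + m + 2 * of_nat r) (n - r) f (rc D l m r g h))
      = (\<Sum>r\<le>n. cst ((-1) ^ n) * rc D (m + l + 2 * of_nat r) k (n - r) (rc D m l r h g) f)"
  proof (rule sum.cong)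
    fix r assume "r \<in> {..n}"
    then have s: "(-1) ^ r * (-1) ^ (n - r) = (-1::complex) ^ n"
      by (simp flip: power_add)
    show "rc D k (l + m + 2 * of_nat r) (n - r) f (rc D l m r g h)
      = cst ((-1) ^ n) * rc D (m + l + 2 * of_nat r) k (n - r) (rc D m l r h g) f"
      by (simp only: rc_commute[OF D, of l m r] rc_scale_right[OF D] rc_commute[OF D, of k _ "n - r"]
          cst_mult_left s add.commute[of l m])
  qed simp
  also have "\<dots> = cst ((-1) ^ n) * (cst (1 / fact n) * ev D k l m f g h ((- ?W) ^ n))"
    unfolding sum_distrib_left[symmetric] sum_rc_rc[OF D] ev_swap13[OF D, of m] swap13_power swap13_w ..
  also have "(- ?W) ^ n = cst ((-1) ^ n) * ?W ^ n"
    unfolding power_minus[of ?W] cst_minus_one_power ..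
  also have "cst ((-1) ^ n) * (cst (1 / fact n) * ev D k l m f g h (cst ((-1) ^ n) * ?W ^ n))
      = cst (((-1) ^ n * (-1) ^ n) * (1 / fact n)) * ev D k l m f g h (?W ^ n)"
    unfolding ev_scale[OF D] cst_mult by (simp only: mult_ac)
  also have "(-1) ^ n * (-1) ^ n = (1::complex)"
    by (simp flip: power_add mult_2)
  finally show ?thesis
    unfolding sum_rc_rc[OF D] by simp
qed

section \<open>The algebra K and its brackets\<close>

lemma X_add: "X (m + n) = X m * X n"
  by (simp add: X_def mult_single)

lemma Kconst_eq: "Kconst = cst"
  by (rule ext) (simp add: Kconst_def)

lemma of_nat_X_split:
  fixes i j :: nat and h :: "nat \<Rightarrow> expo"
  shows "of_nat (i + j) * X (h (i + j - 1)) = of_nat i * X (h (i - 1 + j)) + of_nat j * X (h (i + (j - 1)))"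
  by (cases i; cases j) (simp_all add: algebra_simps)

lemma dmono_add: "dmono u (m + m') = dmono u m * X m' + X m * dmono u m'"
proof -
  obtain a b c d where m: "m = (a,b,c,d)" by (rule prod_cases4)
  obtain a' b' c' d' where m': "m' = (a',b',c',d')" by (rule prod_cases4)
  have 1: "of_nat (a + a') * X (a + a' - 1, b + b', c + c', d + d') = of_nat a * (X (a-1,b,c,d) * X m') + of_nat a' * (X m * X (a'-1,b',c',d'))"
    using of_nat_X_split[of a a' "\<lambda>i. (i, b + b', c + c', d + d')"] by (simp only: m m' X_add[symmetric] add_Pair)
  have 2: "of_nat (b + b') * X (a + a', b + b' - 1, c + c', d + d') = of_nat b * (X (a,b-1,c,d) * X m') + of_nat b' * (X m * X (a',b'-1,c',d'))"
    using of_nat_X_split[of b b' "\<lambda>i. (a + a', i, c + c', d + d')"] by (simp only: m m' X_add[symmetric] add_Pair)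
  have 3: "of_nat (d + d') * X (a + a', b + b', c + c', d + d' - 1) = of_nat d * (X (a,b,c,d-1) * X m') + of_nat d' * (X m * X (a',b',c',d'-1))"
    using of_nat_X_split[of d d' "\<lambda>i. (a + a', b + b', c + c', i)"] by (simp only: m m' X_add[symmetric] add_Pair)
  \<comment> \<open>The exponent of A is an integer, so its subtraction never truncates and no case
    distinction arises.\<close>
  have e: "c - 1 + c' = c + c' - 1" "c + (c' - 1) = c + c' - 1" by simp_all
  have 4: "of_int (c + c') * X (a + a', b + b', c + c' - 1, d + d') = of_int c * (X (a,b,c-1,d) * X m') + of_int c' * (X m * X (a',b',c'-1,d'))"
    by (simp only: m m' X_add[symmetric] add_Pair e of_int_add distrib_right)
  have s: "dmono u (m + m') = of_nat (a + a') * X (a + a' - 1, b + b', c + c', d + d') * dE4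
      + of_nat (b + b') * X (a + a', b + b' - 1, c + c', d + d') * dE6
      + of_int (c + c') * X (a + a', b + b', c + c' - 1, d + d') * dA u
      + of_nat (d + d') * X (a + a', b + b', c + c', d + d' - 1) * dB u"
    by (simp only: m m' add_Pair dmono.simps)
  show ?thesis
    unfolding s 1 2 3 4 by (simp only: m m' dmono.simps distrib_left distrib_right mult_ac add_ac)
qed

lemma dd_eq: "dd u = lext cst (dmono u)"
  by (rule ext) (simp add: dd_def lext_def Kconst_eq)

lemma derivation_dd: "derivation (dd u)"
  unfolding dd_eq by (rule derivation_lext) (simp add: dmono_add X_def)

section \<open>The bigrading\<close>

lemma wt_add: "wt (m + n) = wt m + wt n" and idx_add: "idx (m + n) = idx m + idx n"
  by (cases m; cases n; simp)+

lemma Kdeg_iff: "f \<in> Kdeg k p \<longleftrightarrow> Poly_Mapping.keys f \<subseteq> {m. wt m = k \<and> idx m = p}"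
  unfolding Kdeg_def by blast

lemma Kdeg_zero: "0 \<in> Kdeg k p"
  by (simp add: Kdeg_iff)

lemma Kdeg_add: "f \<in> Kdeg k p \<Longrightarrow> g \<in> Kdeg k p \<Longrightarrow> f + g \<in> Kdeg k p"
  unfolding Kdeg_iff using keys_add[of f g] by (meson subset_trans sup_least)

lemma Kdeg_diff: "f \<in> Kdeg k p \<Longrightarrow> g \<in> Kdeg k p \<Longrightarrow> f - g \<in> Kdeg k p"
  unfolding Kdeg_iff using keys_diff[of f g] by (meson subset_trans sup_least)

lemma Kdeg_sum: "(\<And>a. a \<in> A \<Longrightarrow> f a \<in> Kdeg k p) \<Longrightarrow> sum f A \<in> Kdeg k p"
  by (induction A rule: infinite_finite_induct) (auto simp: Kdeg_zero Kdeg_add)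

lemma Kdeg_mult:
  assumes "f \<in> Kdeg k p" "g \<in> Kdeg l q"
  shows "f * g \<in> Kdeg (k + l) (p + q)"
  unfolding Kdeg_iff
proof
  fix z assume "z \<in> Poly_Mapping.keys (f * g)"
  then obtain x y where "z = x + y" "x \<in> Poly_Mapping.keys f" "y \<in> Poly_Mapping.keys g"
    using keys_mult[of f g] by blast
  then show "z \<in> {m. wt m = k + l \<and> idx m = p + q}"
    using assms by (simp add: Kdeg_def wt_add idx_add)
qed

lemma Kdeg_single: "wt m = k \<Longrightarrow> idx m = p \<Longrightarrow> Poly_Mapping.single m c \<in> Kdeg k p"
  by (cases "c = 0") (simp_all add: Kdeg_iff)

lemma Kdeg_cst: "cst c \<in> Kdeg 0 0"
  by (rule Kdeg_single) (simp_all add: zero_prod_def)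

lemma Kdeg_scale: "f \<in> Kdeg k p \<Longrightarrow> cst c * f \<in> Kdeg k p"
  using Kdeg_mult[OF Kdeg_cst] by simp

lemma Kdeg_scale_of_nat: "f \<in> Kdeg k p \<Longrightarrow> of_nat n * f \<in> Kdeg k p"
  using Kdeg_scale[of f k p "of_nat n"] by simp

lemma Kdeg_scale_of_int: "f \<in> Kdeg k p \<Longrightarrow> of_int n * f \<in> Kdeg k p"
  using Kdeg_scale[of f k p "of_int n"] by simp

lemma Kdeg_cong: "f \<in> Kdeg k p \<Longrightarrow> k = k' \<Longrightarrow> p = p' \<Longrightarrow> f \<in> Kdeg k' p'"
  by simp

lemma vF2_eq: "vF2 = X (0,0,-1,1)"
  by (simp add: vF2_def vB_def vAinv_def X_def mult_single)

lemmas Kdeg_X = Kdeg_single[where c = 1, folded X_def]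

lemma Kdeg_generators:
  "vE4 \<in> Kdeg 4 0" "vE6 \<in> Kdeg 6 0" "vA \<in> Kdeg (-2) 1" "vB \<in> Kdeg 0 1" "vF2 \<in> Kdeg 2 0"
  by (simp_all add: vE4_def vE6_def vA_def vB_def vF2_eq Kdeg_X)

lemma Kdeg_dgenerators:
  "dE4 \<in> Kdeg 6 0" "dE6 \<in> Kdeg 8 0" "dA u \<in> Kdeg 0 1" "dB u \<in> Kdeg 2 1"
  unfolding dE4_def dE6_def dA_def dB_def Kconst_eq power2_eq_square mult.assoc
  using Kdeg_generators Kdeg_mult[OF Kdeg_generators(1) Kdeg_generators(5)]
    Kdeg_mult[OF Kdeg_generators(1,1)] Kdeg_mult[OF Kdeg_generators(2) Kdeg_generators(5)]
    Kdeg_mult[OF Kdeg_generators(4) Kdeg_generators(5)] Kdeg_mult[OF Kdeg_generators(1) Kdeg_generators(3)]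
  by (simp_all add: Kdeg_scale Kdeg_diff)

lemma Kdeg_dmono: "dmono u m \<in> Kdeg (wt m + 2) (idx m)"
proof -
  obtain a b c d where m: "m = (a,b,c,d)" by (rule prod_cases4)
  \<comment> \<open>At a = 0 the truncated exponent gives a monomial of the wrong weight, but its
    coefficient is 0; likewise for the exponents b and d.\<close>
  have 1: "of_nat a * (X (a-1,b,c,d) * dE4) \<in> Kdeg (wt m + 2) (idx m)"
    by (cases "a = 0") (auto simp: m Kdeg_zero of_nat_diff
        intro!: Kdeg_scale_of_nat Kdeg_cong[OF Kdeg_mult[OF Kdeg_X[OF refl refl] Kdeg_dgenerators(1)]])
  have 2: "of_nat b * (X (a,b-1,c,d) * dE6) \<in> Kdeg (wt m + 2) (idx m)"
    by (cases "b = 0") (auto simp: m Kdeg_zero of_nat_diff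
        intro!: Kdeg_scale_of_nat Kdeg_cong[OF Kdeg_mult[OF Kdeg_X[OF refl refl] Kdeg_dgenerators(2)]])
  have 3: "of_int c * (X (a,b,c-1,d) * dA u) \<in> Kdeg (wt m + 2) (idx m)"
    using Kdeg_mult[OF Kdeg_X[OF refl refl, of "(a,b,c-1,d)"] Kdeg_dgenerators(3)]
    by (intro Kdeg_scale_of_int) (simp add: m algebra_simps)
  have 4: "of_nat d * (X (a,b,c,d-1) * dB u) \<in> Kdeg (wt m + 2) (idx m)"
    by (cases "d = 0") (auto simp: m Kdeg_zero of_nat_diff
        intro!: Kdeg_scale_of_nat Kdeg_cong[OF Kdeg_mult[OF Kdeg_X[OF refl refl] Kdeg_dgenerators(4)]])
  show ?thesis
    using Kdeg_add[OF Kdeg_add[OF Kdeg_add[OF 1 2] 3] 4] by (simp add: m mult.assoc)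
qed

lemma Kdeg_dd: "f \<in> Kdeg k p \<Longrightarrow> dd u f \<in> Kdeg (k + 2) p"
  unfolding dd_def Kconst_eq
proof (intro Kdeg_sum Kdeg_scale)
  fix m assume "f \<in> Kdeg k p" "m \<in> Poly_Mapping.keys f"
  then show "dmono u m \<in> Kdeg (k + 2) p"
    using Kdeg_dmono[of u m] by (simp add: Kdeg_def)
qed

lemma Kdeg_funpow_dd: "f \<in> Kdeg k p \<Longrightarrow> (dd u ^^ n) f \<in> Kdeg (k + 2 * int n) p"
  by (induction n) (auto dest: Kdeg_dd simp: algebra_simps)

lemma Kdeg_rc:
  assumes "f \<in> Kdeg k p" "g \<in> Kdeg l q"
  shows "rc (dd u) x y n f g \<in> Kdeg (k + l + 2 * int n) (p + q)"
  unfolding rc_def mult.assoc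
proof (intro Kdeg_sum Kdeg_scale)
  fix r assume "r \<in> {..n}"
  then show "(dd u ^^ r) f * (dd u ^^ (n - r)) g \<in> Kdeg (k + l + 2 * int n) (p + q)"
    by (intro Kdeg_cong[OF Kdeg_mult[OF Kdeg_funpow_dd[OF assms(1)] Kdeg_funpow_dd[OF assms(2)]]])
      (simp_all add: of_nat_diff)
qed

section \<open>Homogeneous components and multilinearity of the brackets\<close>

lemma lookup_hcomp:
  "Poly_Mapping.lookup (hcomp k p f) m = (if wt m = k \<and> idx m = p then Poly_Mapping.lookup f m else 0)"
proof -
  have "hcomp k p f = (\<Sum>m\<in>{m\<in>Poly_Mapping.keys f. wt m = k \<and> idx m = p}. Poly_Mapping.single m (Poly_Mapping.lookup f m))"
    by (simp add: hcomp_def Kconst_eq X_def mult_single)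
  then have "Poly_Mapping.lookup (hcomp k p f) m
     = (\<Sum>x\<in>{m\<in>Poly_Mapping.keys f. wt m = k \<and> idx m = p}. if x = m then Poly_Mapping.lookup f m else 0)"
    by (simp add: lookup_sum lookup_single when_def cong: if_cong)
  also have "\<dots> = (if wt m = k \<and> idx m = p then Poly_Mapping.lookup f m else 0)"
    by (simp add: in_keys_iff)
  finally show ?thesis .
qed

lemma hcomp_add: "hcomp k p (f + g) = hcomp k p f + hcomp k p g"
  by (rule poly_mapping_eqI) (simp add: lookup_hcomp lookup_add)

lemma lookup_scale:
  fixes f :: "'m::comm_monoid_add \<Rightarrow>\<^sub>0 complex"
  shows "Poly_Mapping.lookup (cst c * f) m = c * Poly_Mapping.lookup f m"
  by (induction f rule: poly_mapping_linear_induct)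
    (simp_all add: distrib_left mult_single lookup_add lookup_single when_def)

lemma hcomp_scale: "hcomp k p (cst c * f) = cst c * hcomp k p f"
  by (rule poly_mapping_eqI) (simp add: lookup_hcomp lookup_scale)

lemma hcomp_homogeneous: "f \<in> Kdeg k p \<Longrightarrow> hcomp k p f = f"
  by (rule poly_mapping_eqI) (auto simp: lookup_hcomp Kdeg_def in_keys_iff)

lemma hcomp_eq_zero: "(k, p) \<notin> degs f \<Longrightarrow> hcomp k p f = 0"
  by (rule poly_mapping_eqI) (force simp: lookup_hcomp degs_def in_keys_iff image_iff)

lemma degs_homogeneous: "f \<in> Kdeg k p \<Longrightarrow> degs f \<subseteq> {(k, p)}"
  by (auto simp: degs_def Kdeg_def)

lemma finite_degs: "finite (degs f)"
  by (simp add: degs_def)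

lemma rc_add_left: "derivation D \<Longrightarrow> rc D k l n (f + f') g = rc D k l n f g + rc D k l n f' g"
  by (simp add: rc_def funpow_derivation_add distrib_left distrib_right sum.distrib)

lemma rc_add_right: "derivation D \<Longrightarrow> rc D k l n f (g + g') = rc D k l n f g + rc D k l n f g'"
  by (simp add: rc_def funpow_derivation_add distrib_left distrib_right sum.distrib)

lemma rc_zero: "derivation D \<Longrightarrow> rc D k l n 0 g = 0" "derivation D \<Longrightarrow> rc D k l n f 0 = 0"
  by (simp_all add: rc_def funpow_derivation_zero)

text \<open>The index sets \<open>degs f\<close> and \<open>degs g\<close> vary with the arguments,
  which blocks termwise comparison in the linearity proofs. Missing components are 0, so any common
  finite superset may be used.\<close>

lemma br_superset:
  assumes "finite S" "degs f \<subseteq> S" "finite T" "degs g \<subseteq> T"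
  shows "br u v n f g = (\<Sum>(k,p)\<in>S. \<Sum>(l,q)\<in>T.
    rc (dd u) (of_int k + v * of_int p) (of_int l + v * of_int q) n (hcomp k p f) (hcomp l q g))"
proof -
  have "br u v n f g = (\<Sum>(k,p)\<in>degs f. \<Sum>(l,q)\<in>degs g.
    rc (dd u) (of_int k + v * of_int p) (of_int l + v * of_int q) n (hcomp k p f) (hcomp l q g))"
    by (simp add: br_def rc_def Kconst_eq)
  also have "\<dots> = (\<Sum>(k,p)\<in>degs f. \<Sum>(l,q)\<in>T.
    rc (dd u) (of_int k + v * of_int p) (of_int l + v * of_int q) n (hcomp k p f) (hcomp l q g))"
    using assms by (intro sum.cong refl) (auto intro!: sum.mono_neutral_left
        simp: hcomp_eq_zero rc_zero[OF derivation_dd])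
  also have "\<dots> = (\<Sum>(k,p)\<in>S. \<Sum>(l,q)\<in>T.
    rc (dd u) (of_int k + v * of_int p) (of_int l + v * of_int q) n (hcomp k p f) (hcomp l q g))"
    using assms by (intro sum.mono_neutral_left) (auto simp: hcomp_eq_zero rc_zero[OF derivation_dd])
  finally show ?thesis .
qed

lemma br_homogeneous:
  assumes "f \<in> Kdeg k p" "g \<in> Kdeg l q"
  shows "br u v n f g = rc (dd u) (of_int k + v * of_int p) (of_int l + v * of_int q) n f g"
  using br_superset[OF _ degs_homogeneous[OF assms(1)] _ degs_homogeneous[OF assms(2)]] assms
  by (simp add: hcomp_homogeneous)

lemma br_add_left: "br u v n (f + f') g = br u v n f g + br u v n f' g"
proof -
  let ?S = "degs f \<union> degs f' \<union> degs (f + f')"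
  note * = br_superset[of ?S _ "degs g" g u v n, OF _ _ finite_degs subset_refl]
  show ?thesis
    by (subst (1 2 3) *) (auto simp: finite_degs hcomp_add rc_add_left[OF derivation_dd]
        sum.distrib split_def)
qed

lemma br_add_right: "br u v n f (g + g') = br u v n f g + br u v n f g'"
proof -
  let ?S = "degs g \<union> degs g' \<union> degs (g + g')"
  note * = br_superset[of "degs f" f ?S _ u v n, OF finite_degs subset_refl]
  show ?thesis
    by (subst (1 2 3) *) (auto simp: finite_degs hcomp_add rc_add_right[OF derivation_dd]
        sum.distrib split_def)
qed

lemma br_scale_left: "br u v n (cst c * f) g = cst c * br u v n f g"
proof -
  let ?S = "degs f \<union> degs (cst c * f)"
  note * = br_superset[of ?S _ "degs g" g u v n, OF _ _ finite_degs subset_refl]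
  show ?thesis
    by (subst (1 2) *) (auto simp: finite_degs hcomp_scale rc_scale_left[OF derivation_dd]
        sum_distrib_left split_def)
qed

lemma br_scale_right: "br u v n f (cst c * g) = cst c * br u v n f g"
proof -
  let ?S = "degs g \<union> degs (cst c * g)"
  note * = br_superset[of "degs f" f ?S _ u v n, OF finite_degs subset_refl]
  show ?thesis
    by (subst (1 2) *) (auto simp: finite_degs hcomp_scale rc_scale_right[OF derivation_dd]
        sum_distrib_left split_def)
qed

lemma br_zero_left: "br u v n 0 g = 0" and br_zero_right: "br u v n f 0 = 0"
  by (simp_all add: br_def degs_def)

lemma Kdeg_br:
  "f \<in> Kdeg k p \<Longrightarrow> g \<in> Kdeg l q \<Longrightarrow> br u v n f g \<in> Kdeg (k + l + 2 * int n) (p + q)"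
  by (simp add: br_homogeneous Kdeg_rc)

text \<open>Additivity in each argument reduces the claim to three scaled monomials, which are
  homogeneous. There the weight k + vp is additive and an r-th bracket raises it by 2r, which is the
  pattern of \<open>rc_associative\<close>.\<close>

lemma br_associative:
  "(\<Sum>r\<le>n. br u v (n - r) (br u v r f g) h) = (\<Sum>r\<le>n. br u v (n - r) f (br u v r g h))"
proof (induction f rule: poly_mapping_linear_induct)
  case zero
  show ?case by (simp add: br_zero_left)
next
  case (add m c f)
  let ?f = "Poly_Mapping.single m c"
  have "(\<Sum>r\<le>n. br u v (n - r) (br u v r ?f g) h) = (\<Sum>r\<le>n. br u v (n - r) ?f (br u v r g h))"
  proof (induction g rule: poly_mapping_linear_induct)
    case zero
    show ?case by (simp add: br_zero_left br_zero_right)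
  next
    case (add m' c' g)
    let ?g = "Poly_Mapping.single m' c'"
    have "(\<Sum>r\<le>n. br u v (n - r) (br u v r ?f ?g) h) = (\<Sum>r\<le>n. br u v (n - r) ?f (br u v r ?g h))"
    proof (induction h rule: poly_mapping_linear_induct)
      case zero
      show ?case by (simp add: br_zero_right)
    next
      case (add m'' c'' h)
      let ?h = "Poly_Mapping.single m'' c''"
      let ?w = "\<lambda>m. of_int (wt m) + v * of_int (idx m) :: complex"
      note f = Kdeg_single[OF refl refl, of m c] and g = Kdeg_single[OF refl refl, of m' c']
        and h = Kdeg_single[OF refl refl, of m'' c'']
      have "br u v (n - r) (br u v r ?f ?g) ?h
          = rc (dd u) (?w m + ?w m' + 2 * of_nat r) (?w m'') (n - r) (rc (dd u) (?w m) (?w m') r ?f ?g) ?h" for r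
        unfolding br_homogeneous[OF f g] br_homogeneous[OF Kdeg_rc[OF f g] h]
        by (simp add: algebra_simps)
      moreover have "br u v (n - r) ?f (br u v r ?g ?h)
          = rc (dd u) (?w m) (?w m' + ?w m'' + 2 * of_nat r) (n - r) ?f (rc (dd u) (?w m') (?w m'') r ?g ?h)" for r
        unfolding br_homogeneous[OF g h] br_homogeneous[OF f Kdeg_rc[OF g h]]
        by (simp add: algebra_simps)
      ultimately show ?case
        using add rc_associative[OF derivation_dd] by (simp add: br_add_right sum.distrib)
    qed
    with add show ?case by (simp add: br_add_left br_add_right sum.distrib)
  qed
  with add show ?case by (simp add: br_add_left sum.distrib)
qed

lemma formal_deformation_br: "formal_deformation (br u v)"
proof -
  have "br u v 0 f g = f * g" for f g
  proof (induction f rule: poly_mapping_linear_induct)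
    case (add m c f)
    have "br u v 0 (Poly_Mapping.single m c) g = Poly_Mapping.single m c * g"
      by (induction g rule: poly_mapping_linear_induct)
        (simp_all add: br_zero_right br_add_right distrib_left rc_def
          br_homogeneous[OF Kdeg_single[OF refl refl] Kdeg_single[OF refl refl]])
    with add show ?case by (simp add: br_add_left distrib_right)
  qed (simp add: br_zero_left)
  then show ?thesis
    unfolding formal_deformation_def Kconst_eq
    by (intro conjI allI br_add_left br_add_right br_scale_left br_scale_right br_associative)
qed

section \<open>The subalgebra of index 0 generated by E4, E6, F2\<close>

lemma Qalg_iff: "f \<in> Qalg \<longleftrightarrow> (\<forall>m\<in>Poly_Mapping.keys f. idx m = 0)"
  by (force simp: Qalg_def)

lemma Kdeg_zero_Qalg: "f \<in> Kdeg k 0 \<Longrightarrow> f \<in> Qalg"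
  by (simp add: Qalg_iff Kdeg_def)

lemma poly_mapping_sum_monomials:
  "f = (\<Sum>m\<in>Poly_Mapping.keys f. cst (Poly_Mapping.lookup f m) * X m)"
  using lext_monomials[of f] by (simp add: lext_def X_def)

lemma generator_power:
  "vE4 ^ n = X (n,0,0,0)" "vE6 ^ n = X (0,n,0,0)" "vF2 ^ n = X (0,0,-int n,n)"
  unfolding vE4_def vE6_def vF2_eq
  by (induction n; simp add: X_def mult_single flip: zero_prod_def)+

lemma X_Qalg: "X (a,b,-int d,d) = vE4 ^ a * vE6 ^ b * vF2 ^ d"
  by (simp add: generator_power flip: X_add)

lemma Qalg_induct [consumes 1, case_names cst E4 E6 F2 add mult]:
  assumes "f \<in> Qalg" and const: "\<And>c. P (cst c)" and gen: "P vE4" "P vE6" "P vF2"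
    and add: "\<And>f g. P f \<Longrightarrow> P g \<Longrightarrow> P (f + g)" and mult: "\<And>f g. P f \<Longrightarrow> P g \<Longrightarrow> P (f * g)"
  shows "P f"
proof -
  have pow: "P (h ^ n)" if "P h" for h n
    using const[of 1] by (induction n) (simp_all add: mult that)
  have sum: "P (sum h A)" if "\<And>a. a \<in> A \<Longrightarrow> P (h a)" for h :: "expo \<Rightarrow> K" and A
    using that const[of 0] by (induction A rule: infinite_finite_induct) (simp_all add: add)
  have "P (cst (Poly_Mapping.lookup f m) * X m)" if "m \<in> Poly_Mapping.keys f" for m
  proof -
    obtain a b c d where m: "m = (a,b,c,d)" by (rule prod_cases4)
    with that assms(1) have "c = - int d" by (auto simp: Qalg_def)
    then show ?thesis
      unfolding m by (simp only: X_Qalg) (intro mult const pow gen)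
  qed
  then show ?thesis
    by (subst poly_mapping_sum_monomials) (rule sum)
qed

lemma dd_single: "dd u (X m) = dmono u m"
  by (simp add: dd_eq X_def lext_single unital_ring_hom_cst)

lemma X_one: "X (0,0,0,0) = 1"
  by (simp add: X_def flip: zero_prod_def)

lemma dd_generators:
  "dd u vE4 = cst (-1/3) * (vE6 - vE4 * vF2)"
  "dd u vE6 = cst (-1/2) * (vE4\<^sup>2 - vE6 * vF2)"
  "dd u vF2 = cst (-1/12) * (vE4 - vF2\<^sup>2)"
proof -
  show "dd u vE4 = cst (-1/3) * (vE6 - vE4 * vF2)" "dd u vE6 = cst (-1/2) * (vE4\<^sup>2 - vE6 * vF2)"
    by (simp_all add: vE4_def dd_single X_one dE4_def dE6_def Kconst_eq flip: vE6_def)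
      (simp_all add: vE6_def dd_single X_one dE6_def Kconst_eq vE4_def)
  have "dd u vF2 = - (X (0,0,-2,1) * dA u) + X (0,0,-1,0) * dB u"
    by (simp add: vF2_eq dd_single)
  \<comment> \<open>The contributions of u from A^(-1) and from B are opposite, so the derivative of
    F2 does not depend on u.\<close>
  also have "\<dots> = - (cst u * X (0,0,-2,2)) + (cst (u + 1/12) * X (0,0,-2,2) - cst (1/12) * vE4)"
    by (simp add: dA_def dB_def Kconst_eq vB_def vF2_eq vE4_def vA_def X_def mult_single
        numeral_2_eq_2 algebra_simps)
  also have "\<dots> = cst (-1/12) * (vE4 - X (0,0,-2,2))"
    by (simp add: X_def vE4_def mult_single algebra_simps flip: single_add single_diff single_uminus)
  also have "X (0,0,-2,2) = vF2\<^sup>2"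
    by (simp add: generator_power)
  finally show "dd u vF2 = cst (-1/12) * (vE4 - vF2\<^sup>2)" .
qed

section \<open>Modular forms form a subalgebra of the deformation\<close>

fun lower_mono :: "expo \<Rightarrow> K" where
  "lower_mono (a,b,c,d) = of_nat d * X (a,b,c+1,d-1)"

text \<open>The derivation A d/dB. On C[E4,E6,F2] it is d/dF2, whose kernel is the algebra of modular forms.\<close>
definition lower :: "K \<Rightarrow> K" where
  "lower = lext cst lower_mono"

definition euler :: "K \<Rightarrow> K" where
  "euler = lext cst (\<lambda>m. of_int (wt m) * X m)"

lemma derivation_lower: "derivation lower"
  unfolding lower_def
proof (rule derivation_lext, clarify)
  fix a b d a' b' d' :: nat and c c' :: int
  have "of_nat (d + d') * X (a + a', b + b', c + c' + 1, d + d' - 1)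
      = of_nat d * (X (a,b,c+1,d-1) * X (a',b',c',d')) + of_nat d' * (X (a,b,c,d) * X (a',b',c'+1,d'-1))"
    using of_nat_X_split[of d d' "\<lambda>i. (a + a', b + b', c + c' + 1, i)"]
    by (simp only: X_add[symmetric] add_Pair add_ac)
  then show "lower_mono ((a,b,c,d) + (a',b',c',d')) = lower_mono (a,b,c,d) * Poly_Mapping.single (a',b',c',d') 1
      + Poly_Mapping.single (a,b,c,d) 1 * lower_mono (a',b',c',d')"
    by (simp only: lower_mono.simps X_def[symmetric] add_Pair mult_ac)
qed

lemma derivation_euler: "derivation euler"
  unfolding euler_def by (rule derivation_lext) (simp only: wt_add X_add of_int_add distrib_left distrib_right X_def[symmetric] mult_ac)

lemma lower_single: "lower (Poly_Mapping.single m c) = cst c * lower_mono m"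
  by (simp add: lower_def lext_single unital_ring_hom_cst)

lemma lower_X: "lower (X m) = lower_mono m" and euler_X: "euler (X m) = of_int (wt m) * X m"
  by (simp_all add: lower_def euler_def X_def lext_single unital_ring_hom_cst)

lemma lower_generators: "lower vE4 = 0" "lower vE6 = 0" "lower vF2 = 1"
  by (simp_all add: vE4_def vE6_def vF2_eq lower_X X_one)

lemma euler_generators: "euler vE4 = cst 4 * vE4" "euler vE6 = cst 6 * vE6" "euler vF2 = cst 2 * vF2"
  by (simp_all add: vE4_def vE6_def vF2_eq euler_X)

lemma derivation_cst: "derivation D \<Longrightarrow> D (cst c) = 0"
  using derivation_scale[of D c 1] by (simp add: derivation_one)

lemma euler_homogeneous: "f \<in> Kdeg k p \<Longrightarrow> euler f = cst (of_int k) * f"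
  unfolding euler_def lext_def
  by (subst (4) poly_mapping_sum_monomials)
    (auto simp: sum_distrib_left Kdeg_def mult_ac intro!: sum.cong)

text \<open>The commutator of two derivations is a derivation, and so is \<open>euler\<close>, so
  the generators decide. Writing the weight as the operator \<open>euler\<close> instead of a scalar
  makes the identity meaningful for inhomogeneous elements, as the induction requires. Up to scaling
  this is the sl2 relation.\<close>

lemma lower_dd:
  assumes "f \<in> Qalg"
  shows "lower (dd u f) = dd u (lower f) + cst (1/12) * euler f"
  using assms
proof (induction rule: Qalg_induct)
  case (add f g)
  then show ?case
    by (simp add: derivation_add derivation_lower derivation_euler derivation_dd algebra_simps)
next
  case (mult f g)
  then show ?case
    by (simp add: derivation_add derivation_mult derivation_lower derivation_euler derivation_dd algebra_simps)
next
  case (cst c)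
  then show ?case
    by (simp add: derivation_cst derivation_zero derivation_lower derivation_euler derivation_dd)
next
  case E4
  have "lower (dd u vE4) = cst (-1/3) * - vE4"
    unfolding dd_generators derivation_scale[OF derivation_lower]
    by (simp add: derivation_diff derivation_mult derivation_lower lower_generators)
  then show ?case
    by (simp add: lower_generators euler_generators derivation_zero[OF derivation_dd] cst_mult_left single_uminus
        del: single_numeral)
next
  case E6
  have "lower (dd u vE6) = cst (-1/2) * - vE6"
    unfolding dd_generators derivation_scale[OF derivation_lower]
    by (simp add: derivation_diff derivation_mult derivation_lower lower_generators power2_eq_square)
  then show ?case
    by (simp add: lower_generators euler_generators derivation_zero[OF derivation_dd] cst_mult_left single_uminus
        del: single_numeral)
next
  case F2
  have "lower (dd u vF2) = cst (-1/12) * - (cst 2 * vF2)"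
    unfolding dd_generators derivation_scale[OF derivation_lower]
    by (simp add: derivation_diff derivation_mult derivation_lower lower_generators power2_eq_square)
  then show ?case
    by (simp add: lower_generators euler_generators derivation_one[OF derivation_dd] cst_mult_left single_uminus
        del: single_numeral)
qed

text \<open>Each commutation contributes a twelfth of the current weight, and k + (k+2) + ... +
  (k+2r-2) = r (k+r-1). For r = 0 the coefficient vanishes, so the truncated exponent does not
  matter.\<close>

lemma lower_funpow_dd:
  assumes "f \<in> Kdeg k 0" "lower f = 0"
  shows "lower ((dd u ^^ r) f) = cst (of_nat r * (of_int k + of_nat r - 1) / 12) * (dd u ^^ (r - 1)) f"
proof (induction r)
  case 0
  then show ?case using assms by simp
next
  case (Suc r)
  have *: "dd u (cst (of_nat r * (of_int k + of_nat r - 1) / 12) * (dd u ^^ (r - 1)) f)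
      = cst (of_nat r * (of_int k + of_nat r - 1) / 12) * (dd u ^^ r) f"
    by (cases r) (simp_all add: derivation_scale[OF derivation_dd] derivation_zero[OF derivation_dd])
  note h = Kdeg_funpow_dd[OF assms(1), where u = u and n = r]
  have "lower ((dd u ^^ Suc r) f) = cst (of_nat r * (of_int k + of_nat r - 1) / 12) * (dd u ^^ r) f
      + cst (1/12) * (cst (of_int (k + 2 * int r)) * (dd u ^^ r) f)"
    using lower_dd[OF Kdeg_zero_Qalg[OF h], where u = u] by (simp only: funpow.simps o_apply Suc.IH * euler_homogeneous[OF h])
  also have "\<dots> = cst (of_nat (Suc r) * (of_int k + of_nat (Suc r) - 1) / 12) * (dd u ^^ (Suc r - 1)) f"
    unfolding cst_mult_left distrib_right[symmetric] single_add[symmetric]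
    by (rule arg_cong2[where f = "\<lambda>c g. cst c * g"]) (simp_all add: field_simps)
  finally show ?case .
qed

lemma gbinomial_Suc_mult: "of_nat (Suc k) * (a gchoose Suc k) = (a - of_nat k) * (a gchoose k)" for a :: complex
  using gbinomial_mult_1[of a k] by (simp add: algebra_simps)

text \<open>After applying \<open>lower\<close>, the term r + 1 of the first sum and the term r of
  the second contain the same product of derivatives. Their coefficients cancel by the recursion
  (j+1) (a choose j+1) = (a-j) (a choose j). The two end terms have \<alpha> = 0.\<close>

lemma lower_rc:
  assumes "f \<in> Kdeg k 0" "lower f = 0" "g \<in> Kdeg l 0" "lower g = 0"
  shows "lower (rc (dd u) (of_int k) (of_int l) n f g) = 0"
proof -
  define C :: "nat \<Rightarrow> complex" where "C r = (-1)^r * ((of_int k + of_nat n - 1) gchoose (n - r)) * ((of_int l + of_nat n - 1) gchoose r)" for r :: nat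
  define \<alpha> where "\<alpha> k r = of_nat r * (of_int k + of_nat r - 1) / (12 :: complex)" for k :: int and r
  let ?D = "dd u"
  have "lower (rc ?D (of_int k) (of_int l) n f g)
      = (\<Sum>r\<le>n. cst (C r * \<alpha> k r) * ((?D ^^ (r - 1)) f * (?D ^^ (n - r)) g))
      + (\<Sum>r\<le>n. cst (C r * \<alpha> l (n - r)) * ((?D ^^ r) f * (?D ^^ (n - r - 1)) g))"
    unfolding rc_def C_def[symmetric]
    unfolding mult.assoc derivation_sum[OF derivation_lower] derivation_scale[OF derivation_lower]
    unfolding derivation_mult[OF derivation_lower] lower_funpow_dd[OF assms(1,2), folded \<alpha>_def]
      lower_funpow_dd[OF assms(3,4), folded \<alpha>_def]
    by (simp only: distrib_left sum.distrib cst_mult mult_ac)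
  also have "\<dots> = 0"
  proof (cases n)
    case 0
    then show ?thesis by (simp add: \<alpha>_def)
  next
    case (Suc m)
    have z: "C (Suc r) * \<alpha> k (Suc r) + C r * \<alpha> l (Suc m - r) = 0" if "r \<le> m" for r
    proof -
      have s: "Suc m - r = Suc (m - r)" using that by simp
      have 1: "of_nat (Suc (m - r)) * ((of_int k + of_nat m) gchoose (Suc (m - r)))
          = (of_int k + of_nat r) * ((of_int k + of_nat m :: complex) gchoose (m - r))"
        using gbinomial_Suc_mult[of "m - r" "of_int k + of_nat m"] that by (simp add: of_nat_diff)
      have 2: "of_nat (Suc r) * ((of_int l + of_nat m) gchoose Suc r)
          = (of_int l + of_nat (m - r)) * ((of_int l + of_nat m :: complex) gchoose r)"
        using gbinomial_Suc_mult[of r "of_int l + of_nat m"] that by (simp add: of_nat_diff algebra_simps)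
      have C_Suc: "C (Suc r) = - ((-1) ^ r * ((of_int k + of_nat m) gchoose (m - r)) * ((of_int l + of_nat m) gchoose Suc r))"
        and C: "C r = (-1) ^ r * ((of_int k + of_nat m) gchoose (Suc (m - r))) * ((of_int l + of_nat m) gchoose r)"
        using s by (simp_all add: C_def Suc)
      have \<alpha>: "\<alpha> k (Suc r) = of_nat (Suc r) * (of_int k + of_nat r) * (1/12)" for k r
        by (simp add: \<alpha>_def)
      have "12 * (C (Suc r) * \<alpha> k (Suc r) + C r * \<alpha> l (Suc m - r))
        = (-1) ^ r * (((of_int k + of_nat m) gchoose (Suc (m - r))) * of_nat (Suc (m - r))
              * ((of_int l + of_nat m) gchoose r) * (of_int l + of_nat (m - r))
            - ((of_int k + of_nat m) gchoose (m - r)) * (of_int k + of_nat r)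
              * (of_nat (Suc r) * ((of_int l + of_nat m) gchoose Suc r)))"
        unfolding s C_Suc C \<alpha> by algebra
      also have "\<dots> = 0"
        unfolding 2 mult.commute[of _ "of_nat (Suc (m - r))"] 1 by (simp add: mult_ac)
      finally show ?thesis
        by (simp only: mult_eq_0_iff) simp
    qed
    have "(\<Sum>r\<le>n. cst (C r * \<alpha> k r) * ((?D ^^ (r - 1)) f * (?D ^^ (n - r)) g))
        = (\<Sum>r\<le>m. cst (C (Suc r) * \<alpha> k (Suc r)) * ((?D ^^ r) f * (?D ^^ (m - r)) g))"
      unfolding Suc sum.atMost_Suc_shift by (simp add: \<alpha>_def)
    moreover have "(\<Sum>r\<le>n. cst (C r * \<alpha> l (n - r)) * ((?D ^^ r) f * (?D ^^ (n - r - 1)) g))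
        = (\<Sum>r\<le>m. cst (C r * \<alpha> l (Suc m - r)) * ((?D ^^ r) f * (?D ^^ (m - r)) g))"
      unfolding Suc by (simp add: \<alpha>_def)
    ultimately show ?thesis
      using z by (simp add: distrib_right[symmetric] single_add[symmetric] flip: sum.distrib)
  qed
  finally show ?thesis .
qed

lemma lookup_lower:
  "Poly_Mapping.lookup (lower f) (a,b,c+1,d) = of_nat (Suc d) * Poly_Mapping.lookup f (a,b,c,Suc d)"
proof (induction f rule: poly_mapping_linear_induct)
  case zero
  then show ?case by (simp add: derivation_zero[OF derivation_lower])
next
  case (add m z f)
  obtain a' b' c' d' where m: "m = (a',b',c',d')" by (rule prod_cases4)
  have "lower (Poly_Mapping.single m z) = Poly_Mapping.single (a',b',c'+1,d'-1) (of_nat d' * z)"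
    unfolding m lower_single by (simp add: X_def mult_single mult.commute flip: single_of_nat)
  then have "Poly_Mapping.lookup (lower (Poly_Mapping.single m z)) (a,b,c+1,d)
      = of_nat (Suc d) * Poly_Mapping.lookup (Poly_Mapping.single m z) (a,b,c,Suc d)"
    by (cases d') (auto simp: m lookup_single when_def)
  with add show ?case
    by (simp add: derivation_add[OF derivation_lower] lookup_add distrib_left)
qed

text \<open>In characteristic 0 the derivative d/dF2 annihilates no positive power of F2.\<close>

lemma Mstar_if_lower_eq_zero:
  assumes "f \<in> Qalg" "lower f = 0"
  shows "f \<in> Mstar"
  unfolding Mstar_def
proof clarify
  fix a b c d assume m: "(a,b,c,d) \<in> Poly_Mapping.keys f"
  have "d = 0"
  proof (cases d)
    case (Suc e)
    then show ?thesis
      using m assms(2) lookup_lower[of f a b c e] by (simp add: in_keys_iff del: of_nat_Suc)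
  qed
  with m assms(1) show "c = 0 \<and> d = 0" by (auto simp: Qalg_def)
qed

lemma Mk_Kdeg: "f \<in> Mk k \<Longrightarrow> f \<in> Kdeg k 0"
  by (fastforce simp: Mk_def Kdeg_def)

lemma lower_Mk: "f \<in> Mk k \<Longrightarrow> lower f = 0"
  unfolding lower_def lext_def by (intro sum.neutral) (force simp: Mk_def)

text \<open>Modular forms have index 0, so v drops out of the weights.\<close>

lemma Mk_br:
  assumes "f \<in> Mk k" "g \<in> Mk l"
  shows "br u v n f g = rc (dd u) (of_int k) (of_int l) n f g"
  using br_homogeneous[OF assms[THEN Mk_Kdeg]] by simp

lemma br_Mk_Qalg: "f \<in> Mk k \<Longrightarrow> g \<in> Mk l \<Longrightarrow> br u v n f g \<in> Qalg"
  by (metis Kdeg_br Mk_Kdeg Kdeg_zero_Qalg add_0)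

lemma br_Mk_Mstar: "f \<in> Mk k \<Longrightarrow> g \<in> Mk l \<Longrightarrow> br u v n f g \<in> Mstar"
  by (rule Mstar_if_lower_eq_zero[OF br_Mk_Qalg]) (simp_all add: Mk_br lower_rc Mk_Kdeg lower_Mk)

section \<open>Ramanujan's differential equations\<close>

definition quads :: "nat \<Rightarrow> (nat \<times> nat \<times> nat \<times> nat) set" where
  "quads n = {(a,b,x,y). 0 < a \<and> 0 < b \<and> 0 < x \<and> 0 < y \<and> a * x + b * y = n}"

lemma dvd_div_pos: "d dvd n \<Longrightarrow> 0 < n \<Longrightarrow> 0 < n div (d::nat)"
  by (metis dvd_div_eq_0_iff neq0_conv)

lemma finite_quads: "finite (quads n)"
proof (rule finite_subset)
  show "quads n \<subseteq> {..n} \<times> {..n} \<times> {..n} \<times> {..n}"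
  proof
    fix z assume "z \<in> quads n"
    then obtain a b x y where z: "z = (a,b,x,y)" "0 < a" "0 < b" "0 < x" "0 < y" "a * x + b * y = n"
      unfolding quads_def by blast
    have "a * x \<le> n" "b * y \<le> n" using z(6) by linarith+
    then have "a \<le> n" "x \<le> n" "b \<le> n" "y \<le> n"
      using z order_trans[of a "a * x" n] order_trans[of x "a * x" n]
        order_trans[of b "b * y" n] order_trans[of y "b * y" n] by simp_all
    with z show "z \<in> {..n} \<times> {..n} \<times> {..n} \<times> {..n}" by simp
  qed
qed auto

lemma sum_trichotomy:
  fixes f g :: "'b \<Rightarrow> 'c::linorder"
  assumes "finite A"
  shows "sum h A = sum h {z\<in>A. f z < g z} + sum h {z\<in>A. g z < f z} + sum h {z\<in>A. f z = g z}"
proof -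
  have "sum h A = sum h ({z\<in>A. f z < g z} \<union> {z\<in>A. g z < f z} \<union> {z\<in>A. f z = g z})"
    by (rule arg_cong[where f = "sum h"]) auto
  also have "\<dots> = sum h ({z\<in>A. f z < g z} \<union> {z\<in>A. g z < f z}) + sum h {z\<in>A. f z = g z}"
    using assms by (intro sum.union_disjoint) auto
  also have "sum h ({z\<in>A. f z < g z} \<union> {z\<in>A. g z < f z}) = sum h {z\<in>A. f z < g z} + sum h {z\<in>A. g z < f z}"
    using assms by (intro sum.union_disjoint) auto
  finally show ?thesis .
qed

text \<open>For a = b = d the equation is d (x + y) = n, which leaves n/d - 1 choices of x.\<close>

lemma sum_quads_diagonal_left:
  fixes H :: "nat \<Rightarrow> nat \<Rightarrow> 'a::comm_ring_1"
  assumes "0 < n"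
  shows "(\<Sum>(a,b,x,y)\<in>{(a,b,x,y)\<in>quads n. a = b}. H a b) = (\<Sum>d | d dvd n. (of_nat (n div d) - 1) * H d d)"
proof -
  have "(\<Sum>(a,b,x,y)\<in>{(a,b,x,y)\<in>quads n. a = b}. H a b) = (\<Sum>(d,x)\<in>(SIGMA d:{d. d dvd n}. {0<..<n div d}). H d d)"
  proof (rule sum.reindex_bij_witness[of _ "\<lambda>(d,x). (d,d,x,n div d - x)" "\<lambda>(a,b,x,y). (a,x)"])
    fix z assume "z \<in> {(a,b,x,y)\<in>quads n. a = b}"
    then obtain a x y where z: "z = (a,a,x,y)" "0 < a" "0 < x" "0 < y" "a * (x + y) = n"
      by (auto simp: quads_def distrib_left)
    then have "n div a = x + y" by auto
    with z show "(case case z of (a,b,x,y) \<Rightarrow> (a,x) of (d,x) \<Rightarrow> (d,d,x,n div d - x)) = z"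
      and "(case z of (a,b,x,y) \<Rightarrow> (a,x)) \<in> (SIGMA d:{d. d dvd n}. {0<..<n div d})"
      and "(case case z of (a,b,x,y) \<Rightarrow> (a,x) of (d,x) \<Rightarrow> H d d) = (case z of (a,b,x,y) \<Rightarrow> H a b)"
      by auto
  next
    fix z assume "z \<in> (SIGMA d:{d. d dvd n}. {0<..<n div d})"
    then obtain d x where z: "z = (d,x)" "d dvd n" "0 < x" "x < n div d" by auto
    then have "d * x + d * (n div d - x) = n" "0 < d"
      using assms by (auto simp flip: distrib_left intro: Nat.gr0I)
    with z show "(case case z of (d,x) \<Rightarrow> (d,d,x,n div d - x) of (a,b,x,y) \<Rightarrow> (a,x)) = z"
      and "(case z of (d,x) \<Rightarrow> (d,d,x,n div d - x)) \<in> {(a,b,x,y)\<in>quads n. a = b}"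
      by (auto simp: quads_def)
  qed
  also have "\<dots> = (\<Sum>d | d dvd n. \<Sum>x\<in>{0<..<n div d}. H d d)"
    using assms by (subst sum.Sigma) (auto simp: finite_divisors_nat)
  also have "\<dots> = (\<Sum>d | d dvd n. (of_nat (n div d) - 1) * H d d)"
    using assms by (intro sum.cong) (auto simp: of_nat_diff dvd_div_pos Suc_leI)
  finally show ?thesis .
qed

text \<open>For x = y the equation is (a + b) x = n, so d = a + b is a divisor of n and a runs
  through 0 < a < d.\<close>

lemma sum_quads_diagonal_right:
  fixes H :: "nat \<Rightarrow> nat \<Rightarrow> 'a::comm_ring_1"
  assumes "0 < n"
  shows "(\<Sum>(a,b,x,y)\<in>{(a,b,x,y)\<in>quads n. x = y}. H a (a + b)) = (\<Sum>d | d dvd n. \<Sum>a\<in>{0<..<d}. H a d)"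
proof -
  have "(\<Sum>(a,b,x,y)\<in>{(a,b,x,y)\<in>quads n. x = y}. H a (a + b)) = (\<Sum>(d,a)\<in>(SIGMA d:{d. d dvd n}. {0<..<d}). H a d)"
  proof (rule sum.reindex_bij_witness[of _ "\<lambda>(d,a). (a,d - a,n div d,n div d)" "\<lambda>(a,b,x,y). (a + b,a)"])
    fix z assume "z \<in> {(a,b,x,y)\<in>quads n. x = y}"
    then obtain a b x where z: "z = (a,b,x,x)" "0 < a" "0 < b" "0 < x" "(a + b) * x = n"
      by (auto simp: quads_def distrib_right)
    then have "n div (a + b) = x" by (auto simp del: distrib_right)
    with z show "(case case z of (a,b,x,y) \<Rightarrow> (a + b,a) of (d,a) \<Rightarrow> (a,d - a,n div d,n div d)) = z"
      and "(case z of (a,b,x,y) \<Rightarrow> (a + b,a)) \<in> (SIGMA d:{d. d dvd n}. {0<..<d})"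
      and "(case case z of (a,b,x,y) \<Rightarrow> (a + b,a) of (d,a) \<Rightarrow> H a d) = (case z of (a,b,x,y) \<Rightarrow> H a (a + b))"
      by auto
  next
    fix z assume "z \<in> (SIGMA d:{d. d dvd n}. {0<..<d})"
    then obtain d a where z: "z = (d,a)" "d dvd n" "0 < a" "a < d" by auto
    then have "a * (n div d) + (d - a) * (n div d) = n" "0 < n div d"
      using assms by (auto simp flip: distrib_right intro: dvd_div_pos)
    with z show "(case case z of (d,a) \<Rightarrow> (a,d - a,n div d,n div d) of (a,b,x,y) \<Rightarrow> (a + b,a)) = z"
      and "(case z of (d,a) \<Rightarrow> (a,d - a,n div d,n div d)) \<in> {(a,b,x,y)\<in>quads n. x = y}"
      by (auto simp: quads_def)
  qed
  also have "\<dots> = (\<Sum>d | d dvd n. \<Sum>a\<in>{0<..<d}. H a d)"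
    using assms by (subst sum.Sigma) (auto simp: finite_divisors_nat)
  finally show ?thesis .
qed

text \<open>The substitution (a,b,x,y) = (a',a'+b',x'-y',y') preserves ax+by and exchanges the quadruples
  with a < b for those with y' < x'.  Under both symmetry assumptions the two half sums double to
  the full sums, and only the diagonals a = b and x' = y' remain.\<close>
lemma sum_quads_diff:
  fixes H :: "nat \<Rightarrow> nat \<Rightarrow> 'a::comm_ring_1"
  assumes "0 < n" and sym: "\<And>a b. H a b = H b a" and sym': "\<And>a b. H a (a + b) = H b (a + b)"
  shows "(\<Sum>(a,b,x,y)\<in>quads n. H a b - H a (a + b))
    = (\<Sum>d | d dvd n. (of_nat (n div d) - 1) * H d d - (\<Sum>a\<in>{0<..<d}. H a d))"
proof -
  let ?Q = "quads n"
  let ?h = "\<lambda>(a,b,x,y). H a b" and ?k = "\<lambda>(a,b,x,y). H a (a + b)"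
  let ?a = "\<lambda>(a,b,x,y). a" and ?b = "\<lambda>(a,b,x,y). b" and ?x = "\<lambda>(a,b,x,y). x" and ?y = "\<lambda>(a,b,x,y). y"
  have swap: "sum ?h {z\<in>?Q. ?b z < ?a z} = sum ?h {z\<in>?Q. ?a z < ?b z}"
    by (rule sum.reindex_bij_witness[of _ "\<lambda>(a,b,x,y). (b,a,y,x)" "\<lambda>(a,b,x,y). (b,a,y,x)"])
      (auto simp: quads_def sym)
  have swap': "sum ?k {z\<in>?Q. ?x z < ?y z} = sum ?k {z\<in>?Q. ?y z < ?x z}"
  proof (rule sum.reindex_bij_witness[of _ "\<lambda>(a,b,x,y). (b,a,y,x)" "\<lambda>(a,b,x,y). (b,a,y,x)"])
    fix z :: "nat \<times> nat \<times> nat \<times> nat"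
    obtain a b x y where "z = (a,b,x,y)" by (rule prod_cases4)
    then show "?k (case z of (a,b,x,y) \<Rightarrow> (b,a,y,x)) = ?k z"
      by (simp add: sym'[of a b] add.commute[of b a])
  qed (auto simp: quads_def)
  have main: "sum ?h {z\<in>?Q. ?a z < ?b z} = sum ?k {z\<in>?Q. ?y z < ?x z}"
  proof (rule sum.reindex_bij_witness[of _ "\<lambda>(a,b,x,y). (a,a + b,x - y,y)" "\<lambda>(a,b,x,y). (a,b - a,x + y,y)"])
    fix z assume "z \<in> {z\<in>?Q. ?a z < ?b z}"
    then obtain a b x y where z: "z = (a,b,x,y)" "0 < a" "0 < b" "0 < x" "0 < y" "a * x + b * y = n" "a < b"
      by (auto simp: quads_def)
    have "a * (x + y) + (b - a) * y = a * x + (a + (b - a)) * y"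
      by (simp only: algebra_simps)
    with z have "a * (x + y) + (b - a) * y = n" by simp
    with z show "(case z of (a,b,x,y) \<Rightarrow> (a,b - a,x + y,y)) \<in> {z\<in>?Q. ?y z < ?x z}"
      and "(case case z of (a,b,x,y) \<Rightarrow> (a,b - a,x + y,y) of (a,b,x,y) \<Rightarrow> (a,a + b,x - y,y)) = z"
      and "?k (case z of (a,b,x,y) \<Rightarrow> (a,b - a,x + y,y)) = ?h z"
      by (auto simp: quads_def)
  next
    fix z assume "z \<in> {z\<in>?Q. ?y z < ?x z}"
    then obtain a b x y where z: "z = (a,b,x,y)" "0 < a" "0 < b" "0 < x" "0 < y" "a * x + b * y = n" "y < x"
      by (auto simp: quads_def)
    have "a * (x - y) + (a + b) * y = a * ((x - y) + y) + b * y"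
      by (simp only: algebra_simps)
    with z have "a * (x - y) + (a + b) * y = n" by simp
    with z show "(case z of (a,b,x,y) \<Rightarrow> (a,a + b,x - y,y)) \<in> {z\<in>?Q. ?a z < ?b z}"
      and "(case case z of (a,b,x,y) \<Rightarrow> (a,a + b,x - y,y) of (a,b,x,y) \<Rightarrow> (a,b - a,x + y,y)) = z"
      by (auto simp: quads_def)
  qed
  have "sum ?h ?Q = 2 * sum ?h {z\<in>?Q. ?a z < ?b z} + sum ?h {z\<in>?Q. ?a z = ?b z}"
    using sum_trichotomy[OF finite_quads, of ?h n ?a ?b] by (simp add: swap)
  moreover have "sum ?k ?Q = 2 * sum ?k {z\<in>?Q. ?y z < ?x z} + sum ?k {z\<in>?Q. ?x z = ?y z}"
    using sum_trichotomy[OF finite_quads, of ?k n ?x ?y] by (simp add: swap')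
  moreover have "{z\<in>?Q. ?a z = ?b z} = {(a,b,x,y)\<in>?Q. a = b}" "{z\<in>?Q. ?x z = ?y z} = {(a,b,x,y)\<in>?Q. x = y}"
    by auto
  ultimately have "sum ?h ?Q - sum ?k ?Q
      = (\<Sum>d | d dvd n. (of_nat (n div d) - 1) * H d d) - (\<Sum>d | d dvd n. \<Sum>a\<in>{0<..<d}. H a d)"
    using main sum_quads_diagonal_left[OF assms(1), of H] sum_quads_diagonal_right[OF assms(1), of H]
    by simp
  then show ?thesis
    by (simp add: sum_subtractf[symmetric] split_def)
qed

section \<open>Convolutions of divisor sums\<close>

abbreviation csigma :: "nat \<Rightarrow> nat \<Rightarrow> complex" where
  "csigma j n \<equiv> of_nat (sigma j n)"

text \<open>The terms i = 0 and i = n vanish because sigma j 0 is a sum over an infinite set.\<close>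
definition conv :: "nat \<Rightarrow> nat \<Rightarrow> nat \<Rightarrow> complex" where
  "conv j k n = (\<Sum>i\<le>n. csigma j i * csigma k (n - i))"

lemma sigma_0: "sigma j 0 = 0"
  by (simp add: sigma_def)

lemma csigma_sum: "csigma j n = (\<Sum>d | d dvd n. of_nat d ^ j)"
  by (simp add: sigma_def)

text \<open>A divisor a of i and a divisor b of n - i, with cofactors x and y, amount to a quadruple
  with ax = i and by = n - i.\<close>

lemma conv_quads: "conv j k n = (\<Sum>(a,b,x,y)\<in>quads n. of_nat a ^ j * of_nat b ^ k)"
proof -
  have "conv j k n = (\<Sum>i\<in>{0<..<n}. csigma j i * csigma k (n - i))"
    unfolding conv_def by (intro sum.mono_neutral_right) (auto simp: sigma_0)
  also have "\<dots> = (\<Sum>i\<in>{0<..<n}. \<Sum>(a,b)\<in>{a. a dvd i} \<times> {b. b dvd n - i}. of_nat a ^ j * of_nat b ^ k)"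
    by (simp add: csigma_sum sum_product sum.cartesian_product)
  also have "\<dots> = (\<Sum>(i,a,b)\<in>(SIGMA i:{0<..<n}. {a. a dvd i} \<times> {b. b dvd n - i}). of_nat a ^ j * of_nat b ^ k)"
    by (subst sum.Sigma) (auto simp: finite_divisors_nat split_def)
  also have "\<dots> = (\<Sum>(a,b,x,y)\<in>quads n. of_nat a ^ j * of_nat b ^ k)"
  proof (rule sum.reindex_bij_witness[of _ "\<lambda>(a,b,x,y). (a * x,a,b)" "\<lambda>(i,a,b). (a,b,i div a,(n - i) div b)"])
    fix z assume "z \<in> (SIGMA i:{0<..<n}. {a. a dvd i} \<times> {b. b dvd n - i})"
    then obtain i a b where z: "z = (i,a,b)" "0 < i" "i < n" "a dvd i" "b dvd n - i" by auto
    then have "0 < a" "0 < b" "0 < i div a" "0 < (n - i) div b" "a * (i div a) = i" "b * ((n - i) div b) = n - i"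
      by (auto intro: dvd_div_pos Nat.gr0I)
    with z show "(case case z of (i,a,b) \<Rightarrow> (a,b,i div a,(n - i) div b) of (a,b,x,y) \<Rightarrow> (a * x,a,b)) = z"
      and "(case z of (i,a,b) \<Rightarrow> (a,b,i div a,(n - i) div b)) \<in> quads n"
      and "(case case z of (i,a,b) \<Rightarrow> (a,b,i div a,(n - i) div b) of (a,b,x,y) \<Rightarrow> of_nat a ^ j * of_nat b ^ k)
        = (case z of (i,a,b) \<Rightarrow> (of_nat a ^ j * of_nat b ^ k :: complex))"
      by (auto simp: quads_def)
  next
    fix z assume "z \<in> quads n"
    then obtain a b x y where z: "z = (a,b,x,y)" "0 < a" "0 < b" "0 < x" "0 < y" "a * x + b * y = n"
      by (auto simp: quads_def)
    then have "n - a * x = b * y" by simp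
    with z show "(case case z of (a,b,x,y) \<Rightarrow> (a * x,a,b) of (i,a,b) \<Rightarrow> (a,b,i div a,(n - i) div b)) = z"
      and "(case z of (a,b,x,y) \<Rightarrow> (a * x,a,b)) \<in> (SIGMA i:{0<..<n}. {a. a dvd i} \<times> {b. b dvd n - i})"
      by auto
  qed
  finally show ?thesis .
qed

lemma conv_commute: "conv j k n = conv k j n"
  unfolding conv_def
  by (rule sum.reindex_bij_witness[of _ "\<lambda>i. n - i" "\<lambda>i. n - i"]) auto

text \<open>The factor c clears the denominators of the indefinite sum T. The divisor sums start at
  a = 1, hence the subtracted value at 0.\<close>

lemma sum_telescope_scaled:
  fixes f T :: "nat \<Rightarrow> complex"
  assumes "\<And>a. c * f a = T (Suc a) - T a" "T 0 = 0" "0 < d"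
  shows "c * (\<Sum>a\<in>{0<..<d}. f a) = T d - c * f 0"
proof -
  have "{..<d} = insert 0 {0<..<d}" using assms(3) by auto
  then have "(\<Sum>a<d. f a) = f 0 + (\<Sum>a\<in>{0<..<d}. f a)" by simp
  moreover have "c * (\<Sum>a<d. f a) = T d"
    using sum_lessThan_telescope[of T d] by (simp add: sum_distrib_left assms)
  ultimately show ?thesis by (simp add: algebra_simps)
qed

lemma of_nat_dvd_mult_power:
  assumes "d dvd n"
  shows "(of_nat (n div d) - 1) * of_nat d ^ Suc k = of_nat n * of_nat d ^ k - (of_nat d ^ Suc k :: complex)"
proof -
  have "of_nat (n div d) * of_nat d = (of_nat n :: complex)"
    using assms by (simp flip: of_nat_mult)
  then show ?thesis by (simp add: algebra_simps)
qed

text \<open>The diagonal a = b is the only source of the factor n, and so of the term n \<sigma>_k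
  that becomes the derivative in Ramanujan's equations; w is the value of H at (1, 1). The other
  diagonal gives a power sum in a, evaluated by T.\<close>

lemma sum_quads_polynomial:
  fixes H T :: "nat \<Rightarrow> nat \<Rightarrow> complex"
  assumes n: "0 < n" and sym: "\<And>a b. H a b = H b a" and sym': "\<And>a b. H a (a + b) = H b (a + b)"
    and T: "\<And>a d. c * H a d = T (Suc a) d - T a d" "\<And>d. T 0 d = 0"
    and diag: "\<And>d. H d d = w * of_nat d ^ Suc k"
  shows "c * (\<Sum>(a,b,x,y)\<in>quads n. H a b - H a (a + b))
    = (\<Sum>d | d dvd n. c * w * (of_nat n * of_nat d ^ k - of_nat d ^ Suc k) - (T d d - c * H 0 d))"
  unfolding sum_quads_diff[where H = H, OF n sym sym'] sum_distrib_left
proof (rule sum.cong)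
  fix d assume "d \<in> {d. d dvd n}"
  then have d: "d dvd n" "0 < d" using n by (auto intro: Nat.gr0I)
  have tel: "c * (\<Sum>a\<in>{0<..<d}. H a d) = T d d - c * H 0 d"
    by (rule sum_telescope_scaled[where f = "\<lambda>a. H a d" and T = "\<lambda>a. T a d"]) (simp_all only: T d)
  have "c * ((of_nat (n div d) - 1) * H d d) = c * w * ((of_nat (n div d) - 1) * of_nat d ^ Suc k)"
    unfolding diag by (simp only: mult_ac)
  then show "c * ((of_nat (n div d) - 1) * H d d - (\<Sum>a\<in>{0<..<d}. H a d))
      = c * w * (of_nat n * of_nat d ^ k - of_nat d ^ Suc k) - (T d d - c * H 0 d)"
    unfolding right_diff_distrib of_nat_dvd_mult_power[OF d(1)] tel by (simp only:)
qed simp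

text \<open>The symmetry assumptions of sum_quads_diff say that H is invariant under the dihedral group
  generated by (a,b) \<mapsto> (b,a) and (a,b) \<mapsto> (b-a,b).  Its polynomial invariants are generated
  by a^2-ab+b^2 and (ab(a-b))^2.  In each proof below T is the indefinite sum over a of a
  multiple of H.\<close>
context
  fixes n :: nat
  assumes n: "0 < n"
begin

text \<open>Here H(a,b) - H(a,a+b) = -2ab.\<close>

lemma conv_1_1: "12 * conv 1 1 n = 5 * csigma 3 n + csigma 1 n - 6 * of_nat n * csigma 1 n"
proof -
  let ?H = "\<lambda>a b. of_nat a^2 - of_nat a * of_nat b + of_nat b^2 :: complex"
  let ?T = "\<lambda>N d. (of_nat N + 3 * of_nat N * of_nat d + 6 * of_nat N * of_nat d^2 - 3 * of_nat N^2 - 3 * of_nat N^2 * of_nat d + 2 * of_nat N^3) :: complex"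
  have "- (12 * conv 1 1 n) = 6 * (\<Sum>(a,b,x,y)\<in>quads n. ?H a b - ?H a (a + b))"
    unfolding conv_quads sum_distrib_left sum_negf[symmetric]
    by (intro sum.cong) (auto simp: algebra_simps power2_eq_square)
  also have "\<dots> = (\<Sum>d | d dvd n. 6 * 1 * (of_nat n * of_nat d^1 - of_nat d^Suc 1) - (?T d d - 6 * ?H 0 d))"
    by (rule sum_quads_polynomial[OF n, where H = ?H and T = ?T and c = 6 and w = 1 and k = 1];
        (simp only: of_nat_Suc of_nat_add of_nat_0)?; (algebra | simp add: algebra_simps eval_nat_numeral))
  also have "\<dots> = (\<Sum>d | d dvd n. 6 * of_nat n * of_nat d^1 - 5 * of_nat d^3 - of_nat d^1)"
    by (rule sum.cong; (rule refl | simp add: algebra_simps eval_nat_numeral))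
  also have "\<dots> = 6 * of_nat n * csigma 1 n - 5 * csigma 3 n - csigma 1 n"
    by (simp only: csigma_sum sum_distrib_left sum_subtractf)
  finally show ?thesis by algebra
qed

text \<open>For the squared form the difference is -4ab(a^2 + b^2), which yields
  \<open>conv 1 3\<close> and \<open>conv 3 1\<close> with equal coefficients.\<close>

lemma conv_1_3: "240 * conv 1 3 n = 21 * csigma 5 n + 10 * csigma 3 n - csigma 1 n - 30 * of_nat n * csigma 3 n"
proof -
  let ?H = "\<lambda>a b. (of_nat a^2 - of_nat a * of_nat b + of_nat b^2)^2 :: complex"
  let ?T = "\<lambda>N d. (- of_nat N + 15 * of_nat N * of_nat d^2 + 30 * of_nat N * of_nat d^3 + 30 * of_nat N * of_nat d^4 - 15 * of_nat N^2 * of_nat d - 45 * of_nat N^2 * of_nat d^2 - 30 * of_nat N^2 * of_nat d^3 + 10 * of_nat N^3 + 30 * of_nat N^3 * of_nat d + 30 * of_nat N^3 * of_nat d^2 - 15 * of_nat N^4 - 15 * of_nat N^4 * of_nat d + 6 * of_nat N^5) :: complex"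
  have "- (120 * conv 1 3 n + 120 * conv 3 1 n) = 30 * (\<Sum>(a,b,x,y)\<in>quads n. ?H a b - ?H a (a + b))"
    unfolding conv_quads sum_distrib_left sum.distrib[symmetric] sum_negf[symmetric]
    by (rule sum.cong, rule refl, clarify, simp only: of_nat_add) algebra
  also have "\<dots> = (\<Sum>d | d dvd n. 30 * 1 * (of_nat n * of_nat d^3 - of_nat d^Suc 3) - (?T d d - 30 * ?H 0 d))"
    by (rule sum_quads_polynomial[OF n, where H = ?H and T = ?T and c = 30 and w = 1 and k = 3];
        (simp only: of_nat_Suc of_nat_add of_nat_0)?; (algebra | simp add: algebra_simps eval_nat_numeral))
  also have "\<dots> = (\<Sum>d | d dvd n. 30 * of_nat n * of_nat d^3 - 21 * of_nat d^5 - 10 * of_nat d^3 + of_nat d^1)"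
    by (rule sum.cong; (rule refl | simp add: algebra_simps eval_nat_numeral))
  also have "\<dots> = 30 * of_nat n * csigma 3 n - 21 * csigma 5 n - 10 * csigma 3 n + csigma 1 n"
    by (simp only: csigma_sum sum_distrib_left sum_subtractf sum.distrib)
  finally show ?thesis unfolding conv_commute[of 3] by algebra
qed

text \<open>The difference is a^2 b^2 ((a-b)^2 - (a+b)^2) = -4 a^3 b^3. Since H vanishes for a = b,
  w = 0 and no multiple of n appears: this is the coefficient form of E4^2 = E8.\<close>

lemma conv_3_3: "120 * conv 3 3 n = csigma 7 n - csigma 3 n"
proof -
  let ?H = "\<lambda>a b. (of_nat a * of_nat b * (of_nat a - of_nat b))^2 :: complex"
  let ?T = "\<lambda>N d. (- of_nat N * of_nat d^2 + 5 * of_nat N * of_nat d^4 - 15 * of_nat N^2 * of_nat d^3 - 15 * of_nat N^2 * of_nat d^4 + 10 * of_nat N^3 * of_nat d^2 + 30 * of_nat N^3 * of_nat d^3 + 10 * of_nat N^3 * of_nat d^4 - 15 * of_nat N^4 * of_nat d^2 - 15 * of_nat N^4 * of_nat d^3 + 6 * of_nat N^5 * of_nat d^2) :: complex"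
  have "- (120 * conv 3 3 n) = 30 * (\<Sum>(a,b,x,y)\<in>quads n. ?H a b - ?H a (a + b))"
    unfolding conv_quads sum_distrib_left sum_negf[symmetric]
    by (rule sum.cong, rule refl, clarify, simp only: of_nat_add) algebra
  also have "\<dots> = (\<Sum>d | d dvd n. 30 * 0 * (of_nat n * of_nat d^5 - of_nat d^Suc 5) - (?T d d - 30 * ?H 0 d))"
    by (rule sum_quads_polynomial[OF n, where H = ?H and T = ?T and c = 30 and w = 0 and k = 5];
        (simp only: of_nat_Suc of_nat_add of_nat_0)?; (algebra | simp add: algebra_simps eval_nat_numeral))
  also have "\<dots> = (\<Sum>d | d dvd n. of_nat d^3 - of_nat d^7)"
    by (rule sum.cong; (rule refl | simp add: algebra_simps eval_nat_numeral))
  also have "\<dots> = csigma 3 n - csigma 7 n"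
    by (simp only: csigma_sum sum_subtractf)
  finally show ?thesis by algebra
qed

text \<open>For the cubed form the difference is -6(a^5 b + a b^5) - 14 a^3 b^3; the last term is
  removed by \<open>conv_3_3\<close>. The factor 420 is the common denominator of the coefficients
  of the indefinite sum.\<close>

lemma conv_1_5: "504 * conv 1 5 n = 20 * csigma 7 n + 21 * csigma 5 n + csigma 1 n - 42 * of_nat n * csigma 5 n"
proof -
  let ?H = "\<lambda>a b. (of_nat a^2 - of_nat a * of_nat b + of_nat b^2)^3 :: complex"
  let ?T = "\<lambda>N d. (10 * of_nat N - 84 * of_nat N * of_nat d^2 + 420 * of_nat N * of_nat d^4 + 630 * of_nat N * of_nat d^5 + 420 * of_nat N * of_nat d^6 + 105 * of_nat N^2 * of_nat d - 735 * of_nat N^2 * of_nat d^3 - 1260 * of_nat N^2 * of_nat d^4 - 630 * of_nat N^2 * of_nat d^5 - 70 * of_nat N^3 + 840 * of_nat N^3 * of_nat d^2 + 1470 * of_nat N^3 * of_nat d^3 + 840 * of_nat N^3 * of_nat d^4 - 525 * of_nat N^4 * of_nat d - 1260 * of_nat N^4 * of_nat d^2 - 735 * of_nat N^4 * of_nat d^3 + 210 * of_nat N^5 + 630 * of_nat N^5 * of_nat d + 504 * of_nat N^5 * of_nat d^2 - 210 * of_nat N^6 - 210 * of_nat N^6 * of_nat d + 60 * of_nat N^7) :: complex"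
  have "- (2520 * conv 1 5 n + 2520 * conv 5 1 n + 5880 * conv 3 3 n) = 420 * (\<Sum>(a,b,x,y)\<in>quads n. ?H a b - ?H a (a + b))"
    unfolding conv_quads sum_distrib_left sum.distrib[symmetric] sum_negf[symmetric]
    by (rule sum.cong, rule refl, clarify, simp only: of_nat_add) algebra
  also have "\<dots> = (\<Sum>d | d dvd n. 420 * 1 * (of_nat n * of_nat d^5 - of_nat d^Suc 5) - (?T d d - 420 * ?H 0 d))"
    by (rule sum_quads_polynomial[OF n, where H = ?H and T = ?T and c = 420 and w = 1 and k = 5];
        (simp only: of_nat_Suc of_nat_add of_nat_0)?; (algebra | simp add: algebra_simps eval_nat_numeral))
  also have "\<dots> = (\<Sum>d | d dvd n. 420 * of_nat n * of_nat d^5 - 249 * of_nat d^7 - 210 * of_nat d^5 + 49 * of_nat d^3 - 10 * of_nat d^1)"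
    by (rule sum.cong; (rule refl | simp add: algebra_simps eval_nat_numeral))
  also have "\<dots> = 420 * of_nat n * csigma 5 n - 249 * csigma 7 n - 210 * csigma 5 n + 49 * csigma 3 n - 10 * csigma 1 n"
    by (simp only: csigma_sum sum_distrib_left sum_subtractf sum.distrib)
  finally show ?thesis using conv_3_3 unfolding conv_commute[of 5] by algebra
qed

end

section \<open>The q-expansions as power series\<close>

unbundle fps_syntax

definition eisf :: "complex \<Rightarrow> nat \<Rightarrow> complex fps" where
  "eisf c j = 1 + fps_const c * Abs_fps (csigma j)"

lemma eisf_mult_nth:
  "(eisf c j * eisf e k) $ n = (if n = 0 then 1 else 0) + c * csigma j n + e * csigma k n + c * e * conv j k n"
proof -
  have "eisf c j * eisf e k = 1 + fps_const c * Abs_fps (csigma j) + fps_const e * Abs_fps (csigma k)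
      + fps_const (c * e) * (Abs_fps (csigma j) * Abs_fps (csigma k))"
    unfolding fps_const_mult[symmetric] by (simp add: eisf_def algebra_simps del: fps_const_mult)
  moreover have "(Abs_fps (csigma j) * Abs_fps (csigma k)) $ n = conv j k n"
    by (simp add: fps_mult_nth conv_def atLeast0AtMost)
  ultimately show ?thesis by simp
qed

lemma eisf_nth: "eisf c j $ n = (if n = 0 then 1 else 0) + c * csigma j n"
  by (simp add: eisf_def)

lemma theta_nth: "(fps_X * fps_deriv f) $ n = of_nat n * (f $ n)" for f :: "complex fps"
  by (cases n) simp_all

text \<open>On q-expansions the operator D is X d/dX, and each equation is a convolution identity
  read coefficientwise. Those identities need n > 0; at n = 0 both sides vanish. The third equation
  involves two products and so takes \<open>conv_3_3\<close> as well.\<close>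

lemma ramanujan_fps:
  "fps_const 12 * (fps_X * fps_deriv (eisf (-24) 1)) = eisf (-24) 1 * eisf (-24) 1 - eisf 240 3"
  "fps_const 3 * (fps_X * fps_deriv (eisf 240 3)) = eisf (-24) 1 * eisf 240 3 - eisf (-504) 5"
  "fps_const 2 * (fps_X * fps_deriv (eisf (-504) 5)) = eisf (-24) 1 * eisf (-504) 5 - eisf 240 3 * eisf 240 3"
proof -
  have "(fps_const 12 * (fps_X * fps_deriv (eisf (-24) 1))) $ n = (eisf (-24) 1 * eisf (-24) 1 - eisf 240 3) $ n" for n
  proof (cases "n = 0")
    case False
    then show ?thesis
      using conv_1_1[of n] unfolding fps_mult_left_const_nth theta_nth fps_sub_nth eisf_mult_nth eisf_nth
      by simp algebra
  qed (simp add: eisf_nth sigma_0)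
  then show "fps_const 12 * (fps_X * fps_deriv (eisf (-24) 1)) = eisf (-24) 1 * eisf (-24) 1 - eisf 240 3"
    by (intro fps_ext)
  have "(fps_const 3 * (fps_X * fps_deriv (eisf 240 3))) $ n = (eisf (-24) 1 * eisf 240 3 - eisf (-504) 5) $ n" for n
  proof (cases "n = 0")
    case False
    then show ?thesis
      using conv_1_3[of n] unfolding fps_mult_left_const_nth theta_nth fps_sub_nth eisf_mult_nth eisf_nth
      by simp algebra
  qed (simp add: eisf_nth sigma_0)
  then show "fps_const 3 * (fps_X * fps_deriv (eisf 240 3)) = eisf (-24) 1 * eisf 240 3 - eisf (-504) 5"
    by (intro fps_ext)
  have "(fps_const 2 * (fps_X * fps_deriv (eisf (-504) 5))) $ n = (eisf (-24) 1 * eisf (-504) 5 - eisf 240 3 * eisf 240 3) $ n" for n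
  proof (cases "n = 0")
    case False
    then show ?thesis
      using conv_1_5[of n] conv_3_3[of n] unfolding fps_mult_left_const_nth theta_nth fps_sub_nth eisf_mult_nth eisf_nth
      by simp algebra
  qed (simp add: eisf_nth sigma_0)
  then show "fps_const 2 * (fps_X * fps_deriv (eisf (-504) 5)) = eisf (-24) 1 * eisf (-504) 5 - eisf 240 3 * eisf 240 3"
    by (intro fps_ext)
qed

text \<open>The operator X d/dX multiplies the n-th coefficient by n without decreasing the radius;
  the induction starts from the geometric series.\<close>

lemma fps_conv_radius_powers: "1 \<le> fps_conv_radius (Abs_fps (\<lambda>n. of_nat n ^ k :: real))"
proof (induction k)
  case 0
  show ?case
    unfolding fps_conv_radius_def
    by (rule conv_radius_geI_ex') (simp add: summable_geometric)
next
  case (Suc k)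
  let ?f = "Abs_fps (\<lambda>n. of_nat n ^ k :: real)"
  have "Abs_fps (\<lambda>n. of_nat n ^ Suc k :: real) = fps_X * fps_deriv ?f"
  proof (rule fps_ext)
    fix n show "Abs_fps (\<lambda>n. of_nat n ^ Suc k :: real) $ n = (fps_X * fps_deriv ?f) $ n"
      by (cases n) simp_all
  qed
  moreover have "min (fps_conv_radius (fps_X :: real fps)) (fps_conv_radius (fps_deriv ?f))
      \<le> fps_conv_radius (fps_X * fps_deriv ?f)"
    by (rule fps_conv_radius_mult)
  moreover have "1 \<le> fps_conv_radius (fps_deriv ?f)"
    using Suc fps_conv_radius_deriv order_trans by blast
  ultimately show ?case by simp
qed

lemma sigma_le: "sigma j n \<le> n ^ Suc j"
proof (cases "n = 0")
  case False
  then have sub: "{d. d dvd n} \<subseteq> {1..n}" by (auto intro: dvd_imp_le Nat.gr0I simp: Suc_le_eq)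
  have "sigma j n \<le> (\<Sum>d\<in>{d. d dvd n}. n ^ j)"
    unfolding sigma_def using sub by (intro sum_mono power_mono) auto
  also have "\<dots> \<le> n * n ^ j"
    using card_mono[OF _ sub] by simp
  finally show ?thesis by simp
qed (simp add: sigma_0)

lemma fps_conv_radius_csigma: "1 \<le> fps_conv_radius (Abs_fps (csigma j))"
  unfolding fps_conv_radius_def
proof (rule conv_radius_geI_ex')
  fix r :: real assume r: "0 < r" "ereal r < 1"
  then have "ereal (norm r) < fps_conv_radius (Abs_fps (\<lambda>n. of_nat n ^ Suc j :: real))"
    using order.strict_trans2[OF r(2) fps_conv_radius_powers[of "Suc j"]] by simp
  from norm_summable_fps[OF this] have s: "summable (\<lambda>n. of_nat n ^ Suc j * r ^ n)"
    using r by (simp add: norm_mult norm_power)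
  show "summable (\<lambda>n. Abs_fps (csigma j) $ n * of_real r ^ n)"
  proof (rule summable_comparison_test'[OF s])
    fix n
    have "real (sigma j n) \<le> of_nat n ^ Suc j"
      using sigma_le[of j n] by (simp flip: of_nat_power of_nat_mult)
    then show "norm (Abs_fps (csigma j) $ n * of_real r ^ n) \<le> of_nat n ^ Suc j * r ^ n"
      using r by (simp add: norm_mult norm_power mult_right_mono del: power_Suc)
  qed
qed

lemma fps_conv_radius_csigma_scaled: "1 \<le> fps_conv_radius (fps_const c * Abs_fps (csigma j))"
  using fps_conv_radius_csigma[of j] by (cases "c = 0") (simp_all add: fps_conv_radius_cmult_left)

lemma fps_conv_radius_eisf: "1 \<le> fps_conv_radius (eisf c j)"
  using fps_conv_radius_add[of 1 "fps_const c * Abs_fps (csigma j)"] fps_conv_radius_csigma_scaled[of c j]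
  unfolding eisf_def by (simp add: min_def split: if_splits)

section \<open>Passage to functions on the upper half plane\<close>

lemma norm_nome_less_1: "0 < Im \<tau> \<Longrightarrow> norm (exp (2 * of_real pi * \<i> * \<tau>)) < 1"
  by (simp add: norm_exp_eq_Re)

context
  fixes z :: complex
  assumes z: "norm z < 1"
begin

lemma in_radius: "1 \<le> fps_conv_radius f \<Longrightarrow> ereal (norm z) < fps_conv_radius f" for f :: "complex fps"
  using z by (meson ereal_less(3) less_le_trans)

lemma eval_eisf: "eval_fps (eisf c j) z = 1 + c * suminf (\<lambda>n. csigma j (Suc n) * z ^ Suc n)"
proof -
  have "eval_fps (eisf c j) z = 1 + c * eval_fps (Abs_fps (csigma j)) z"
  proof -
    have "eval_fps (eisf c j) z = eval_fps 1 z + eval_fps (fps_const c * Abs_fps (csigma j)) z"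
      unfolding eisf_def by (rule eval_fps_add) (simp_all add: in_radius fps_conv_radius_csigma_scaled)
    also have "eval_fps (fps_const c * Abs_fps (csigma j)) z = eval_fps (fps_const c) z * eval_fps (Abs_fps (csigma j)) z"
      by (rule eval_fps_mult) (simp_all add: in_radius fps_conv_radius_csigma)
    finally show ?thesis by simp
  qed
  also have "eval_fps (Abs_fps (csigma j)) z = suminf (\<lambda>n. csigma j (Suc n) * z ^ Suc n)"
    using suminf_split_head[OF summable_fps[OF in_radius[OF fps_conv_radius_csigma]]]
    by (simp add: eval_fps_def sigma_0)
  finally show ?thesis .
qed

lemma eval_eisf_mult: "eval_fps (eisf c j * eisf e k) z = eval_fps (eisf c j) z * eval_fps (eisf e k) z"
  by (intro eval_fps_mult in_radius fps_conv_radius_eisf)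

end

lemma Eis_eval:
  assumes "0 < Im \<tau>"
  defines "z \<equiv> exp (2 * of_real pi * \<i> * \<tau>)"
  shows "Eis2 \<tau> = eval_fps (eisf (-24) 1) z" "Eis4 \<tau> = eval_fps (eisf 240 3) z" "Eis6 \<tau> = eval_fps (eisf (-504) 5) z"
proof -
  have q: "qterm n \<tau> = z ^ n" for n
    unfolding z_def qterm_def by (simp add: mult_ac flip: exp_of_nat_mult)
  have "norm z < 1" unfolding z_def using assms(1) by (rule norm_nome_less_1)
  note e = eval_eisf[OF this]
  show "Eis2 \<tau> = eval_fps (eisf (-24) 1) z" "Eis4 \<tau> = eval_fps (eisf 240 3) z" "Eis6 \<tau> = eval_fps (eisf (-504) 5) z"
    unfolding Eis2_def Eis4_def Eis6_def e q by simp_all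
qed

text \<open>The derivative of q is 2 \<pi> i q, and the factor q joins the differentiated series to
  form X d/dX.\<close>

lemma has_field_derivative_eisf:
  assumes "0 < Im \<tau>" and E: "\<And>\<tau>. 0 < Im \<tau> \<Longrightarrow> E \<tau> = eval_fps (eisf c j) (exp (2 * of_real pi * \<i> * \<tau>))"
  shows "(E has_field_derivative (2 * of_real pi * \<i>) *
    eval_fps (fps_X * fps_deriv (eisf c j)) (exp (2 * of_real pi * \<i> * \<tau>))) (at \<tau>)"
proof -
  let ?q = "\<lambda>\<tau>. exp (2 * of_real pi * \<i> * \<tau>)"
  note z = norm_nome_less_1[OF assms(1)]
  have "(?q has_field_derivative ?q \<tau> * (2 * of_real pi * \<i>)) (at \<tau>)"
    by (auto intro!: derivative_eq_intros)
  from DERIV_chain2[OF has_field_derivative_eval_fps[OF in_radius[OF z fps_conv_radius_eisf]] this]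
  have "((\<lambda>\<tau>. eval_fps (eisf c j) (?q \<tau>)) has_field_derivative
      eval_fps (fps_deriv (eisf c j)) (?q \<tau>) * (?q \<tau> * (2 * of_real pi * \<i>))) (at \<tau>)" .
  moreover have "eval_fps (fps_X * fps_deriv (eisf c j)) (?q \<tau>) = ?q \<tau> * eval_fps (fps_deriv (eisf c j)) (?q \<tau>)"
    using eval_fps_mult[OF _ in_radius[OF z order_trans[OF fps_conv_radius_eisf fps_conv_radius_deriv]]]
    by simp
  ultimately have "((\<lambda>\<tau>. eval_fps (eisf c j) (?q \<tau>)) has_field_derivative (2 * of_real pi * \<i>) *
    eval_fps (fps_X * fps_deriv (eisf c j)) (?q \<tau>)) (at \<tau>)"
    by (simp add: mult_ac)
  then show ?thesis
    \<comment> \<open>\<open>E\<close> is known to equal the series only for Im \<tau> > 0, but this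
      set is open.\<close>
    by (rule has_field_derivative_transform_within_open[OF _ open_halfspace_Im_gt[of 0]])
      (use assms in auto)
qed

lemma eval_eisf_linear:
  assumes "norm z < 1" and F: "fps_const c * F = eisf a j * eisf b k - G" "c \<noteq> 0" "1 \<le> fps_conv_radius G"
  shows "eval_fps F z = (eval_fps (eisf a j) z * eval_fps (eisf b k) z - eval_fps G z) / c"
proof -
  note r = in_radius[OF assms(1)]
  have p: "1 \<le> fps_conv_radius (eisf a j * eisf b k)"
    using fps_conv_radius_mult[of "eisf a j" "eisf b k"] fps_conv_radius_eisf[of a j] fps_conv_radius_eisf[of b k]
    by (meson min.boundedI order_trans)
  have d: "1 \<le> fps_conv_radius (eisf a j * eisf b k - G)"
    using fps_conv_radius_diff[of "eisf a j * eisf b k" G] p assms(4) by (meson min.boundedI order_trans)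
  have "F = fps_const (1 / c) * (eisf a j * eisf b k - G)"
    using F(2) by (simp flip: F(1) mult.assoc)
  then have "eval_fps F z = (1 / c) * eval_fps (eisf a j * eisf b k - G) z"
    using r[OF d] by (simp add: eval_fps_mult)
  also have "eval_fps (eisf a j * eisf b k - G) z = eval_fps (eisf a j * eisf b k) z - eval_fps G z"
    using r[OF p] r[OF assms(4)] by (rule eval_fps_diff)
  finally show ?thesis
    by (simp add: eval_eisf_mult[OF assms(1)])
qed

lemma Eis_has_field_derivative:
  assumes "0 < Im \<tau>"
  shows "(Eis2 has_field_derivative (2 * of_real pi * \<i>) * ((Eis2 \<tau>)\<^sup>2 - Eis4 \<tau>) / 12) (at \<tau>)"
    and "(Eis4 has_field_derivative (2 * of_real pi * \<i>) * (Eis2 \<tau> * Eis4 \<tau> - Eis6 \<tau>) / 3) (at \<tau>)"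
    and "(Eis6 has_field_derivative (2 * of_real pi * \<i>) * (Eis2 \<tau> * Eis6 \<tau> - (Eis4 \<tau>)\<^sup>2) / 2) (at \<tau>)"
proof -
  let ?z = "exp (2 * of_real pi * \<i> * \<tau>)"
  note z = norm_nome_less_1[OF assms]
  have p: "1 \<le> fps_conv_radius (eisf 240 3 * eisf 240 3)"
    using fps_conv_radius_mult[of "eisf 240 3" "eisf 240 3"] fps_conv_radius_eisf[of 240 3] by simp
  have c: "(12::complex) \<noteq> 0" "(3::complex) \<noteq> 0" "(2::complex) \<noteq> 0" by simp_all
  note e = Eis_eval[OF assms] eval_eisf_mult[OF z]
  show "(Eis2 has_field_derivative (2 * of_real pi * \<i>) * ((Eis2 \<tau>)\<^sup>2 - Eis4 \<tau>) / 12) (at \<tau>)"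
    using has_field_derivative_eisf[OF assms Eis_eval(1)]
    unfolding eval_eisf_linear[OF z ramanujan_fps(1) c(1) fps_conv_radius_eisf]
    by (simp only: e power2_eq_square times_divide_eq_right)
  show "(Eis4 has_field_derivative (2 * of_real pi * \<i>) * (Eis2 \<tau> * Eis4 \<tau> - Eis6 \<tau>) / 3) (at \<tau>)"
    using has_field_derivative_eisf[OF assms Eis_eval(2)]
    unfolding eval_eisf_linear[OF z ramanujan_fps(2) c(2) fps_conv_radius_eisf]
    by (simp only: e power2_eq_square times_divide_eq_right)
  show "(Eis6 has_field_derivative (2 * of_real pi * \<i>) * (Eis2 \<tau> * Eis6 \<tau> - (Eis4 \<tau>)\<^sup>2) / 2) (at \<tau>)"
    using has_field_derivative_eisf[OF assms Eis_eval(3)]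
    unfolding eval_eisf_linear[OF z ramanujan_fps(3) c(3) p]
    by (simp only: e power2_eq_square times_divide_eq_right)
qed

section \<open>Comparison with the Rankin--Cohen brackets of modular forms\<close>

lemma omega_eq: "omega f \<tau> = lext (\<lambda>x. x) (\<lambda>(a,b,c,d). Eis4 \<tau> ^ a * Eis6 \<tau> ^ b * Eis2 \<tau> ^ d) f"
  by (auto simp: omega_def lext_def mult.assoc intro!: sum.cong)

lemma omega_add: "omega (f + g) \<tau> = omega f \<tau> + omega g \<tau>"
  and omega_diff: "omega (f - g) \<tau> = omega f \<tau> - omega g \<tau>"
  and omega_sum: "omega (sum h A) \<tau> = (\<Sum>a\<in>A. omega (h a) \<tau>)"
  and omega_cst: "omega (cst c) \<tau> = c"
  by (simp_all add: omega_eq lext_add lext_diff lext_sum lext_single unital_ring_hom_id zero_prod_def)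

text \<open>Since \<open>omega\<close> ignores the exponent of A, it is the homomorphism A \<mapsto>
  1, B \<mapsto> E2 on all of K. For u \<noteq> 0 it does not intertwine the derivations there, as
  \<open>dA u\<close> goes to u E2; hence the restriction to \<open>Qalg\<close> below.\<close>

lemma omega_mult: "omega (f * g) \<tau> = omega f \<tau> * omega g \<tau>"
  unfolding omega_eq by (rule lext_mult[OF unital_ring_hom_id]) (auto simp: power_add mult_ac)

lemma omega_generators: "omega vE4 = Eis4" "omega vE6 = Eis6" "omega vF2 = Eis2"
  by (simp_all add: fun_eq_iff omega_eq vE4_def vE6_def vF2_eq X_def lext_single unital_ring_hom_id)

text \<open>Both sides obey the Leibniz rule along \<open>omega\<close>, so the three generators
  decide, and there the claim is Ramanujan's system.\<close>

lemma has_field_derivative_omega: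
  assumes "f \<in> Qalg" "0 < Im \<tau>"
  shows "(omega f has_field_derivative (2 * of_real pi * \<i>) * omega (dd u f) \<tau>) (at \<tau>)"
  using assms(1)
proof (induction rule: Qalg_induct)
  case (cst c)
  have "omega (cst c) = (\<lambda>_. c)" by (simp add: fun_eq_iff omega_cst)
  then show ?case
    using omega_cst[of 0 \<tau>] by (simp add: derivation_cst[OF derivation_dd])
next
  case E4
  show ?case
    unfolding omega_generators
    by (rule DERIV_cong[OF Eis_has_field_derivative(2)[OF assms(2)]]) (simp add: dd_generators omega_mult omega_diff omega_cst omega_generators field_simps)
next
  case E6
  show ?case
    unfolding omega_generators
    by (rule DERIV_cong[OF Eis_has_field_derivative(3)[OF assms(2)]]) (simp add: dd_generators omega_mult omega_diff omega_cst omega_generators power2_eq_square field_simps)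
next
  case F2
  show ?case
    unfolding omega_generators
    by (rule DERIV_cong[OF Eis_has_field_derivative(1)[OF assms(2)]]) (simp add: dd_generators omega_mult omega_diff omega_cst omega_generators power2_eq_square field_simps)
next
  case (add f g)
  have "omega (f + g) = (\<lambda>\<tau>. omega f \<tau> + omega g \<tau>)" by (simp add: fun_eq_iff omega_add)
  with DERIV_add[OF add] show ?case
    by (simp add: derivation_add[OF derivation_dd] omega_add distrib_left)
next
  case (mult f g)
  have "omega (f * g) = (\<lambda>\<tau>. omega f \<tau> * omega g \<tau>)" by (simp add: fun_eq_iff omega_mult)
  with DERIV_mult[OF mult] show ?case
    by (simp add: derivation_mult[OF derivation_dd] omega_add omega_mult algebra_simps)
qed

lemma Dop_funpow_omega:
  assumes "f \<in> Kdeg k 0" "0 < Im \<tau>"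
  shows "(Dop ^^ i) (omega f) \<tau> = omega ((dd u ^^ i) f) \<tau>"
  using assms(2)
proof (induction i arbitrary: \<tau>)
  case (Suc i)
  \<comment> \<open>The induction hypothesis concerns points of the half plane only; differentiating
    it requires equality on a neighbourhood of \<tau>.\<close>
  have "eventually (\<lambda>z. z \<in> {z. 0 < Im z}) (nhds \<tau>)"
    using Suc.prems by (intro eventually_nhds_in_open open_halfspace_Im_gt) simp
  then have "eventually (\<lambda>z. (Dop ^^ i) (omega f) z = omega ((dd u ^^ i) f) z) (nhds \<tau>)"
    by eventually_elim (simp add: Suc.IH)
  then have "deriv ((Dop ^^ i) (omega f)) \<tau> = deriv (omega ((dd u ^^ i) f)) \<tau>"
    by (rule deriv_cong_ev) simp
  also have "\<dots> = (2 * of_real pi * \<i>) * omega ((dd u ^^ Suc i) f) \<tau>"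
    using has_field_derivative_omega[OF Kdeg_zero_Qalg[OF Kdeg_funpow_dd[OF assms(1)]] Suc.prems]
    by (simp add: DERIV_imp_deriv)
  finally show ?case
    by (simp add: Dop_def[of "(Dop ^^ i) (omega f)"])
qed simp

lemma omega_br:
  assumes "f \<in> Mk k" "g \<in> Mk l" "0 < Im \<tau>"
  shows "omega (br u v n f g) \<tau> = RC k l n (omega f) (omega g) \<tau>"
  unfolding Mk_br[OF assms(1,2)] RC_def rc_def omega_sum
  by (simp add: omega_mult omega_cst Dop_funpow_omega[OF Mk_Kdeg[OF assms(1)] assms(3), where u = u]
      Dop_funpow_omega[OF Mk_Kdeg[OF assms(2)] assms(3), where u = u])

theorem theorem3:
  fixes u v :: complex
  shows "formal_deformation (br u v)
    \<and> (\<forall>k p l q n f g. f \<in> Kdeg k p \<longrightarrow> g \<in> Kdeg l q \<longrightarrow>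
          br u v n f g \<in> Kdeg (k + l + 2 * int n) (p + q))
    \<and> (\<forall>k l n f g. f \<in> Mk k \<longrightarrow> g \<in> Mk l \<longrightarrow>
          br u v n f g \<in> Qalg
          \<and> (\<forall>\<tau>. 0 < Im \<tau> \<longrightarrow> omega (br u v n f g) \<tau> = RC k l n (omega f) (omega g) \<tau>)
          \<and> br u v n f g \<in> Mstar)"
  by (intro conjI allI impI formal_deformation_br Kdeg_br br_Mk_Qalg omega_br br_Mk_Mstar)

end
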